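(* Let $G$ be a finite nonabelian group. Then $G$ is a nested GVZ-group (that is, $G$ is both nested and a GVZ-group) if and only if for all elements $g, h \in G$, either $\gamma_G(g) \subseteq \gamma_G(h)$ or $\gamma_G(h) \subseteq \gamma_G(g)$.
   Context: $\mathrm{Irr}(G)$ denotes the set of irreducible complex characters of the finite group $G$. For $\chi \in \mathrm{Irr}(G)$, the center $Z(\chi)$ of $\chi$ is the subgroup of $G$ containing $\ker(\chi)$ determined by $Z(\chi)/\ker(\chi) = Z(G/\ker(\chi))$ (equivalently, $Z(\chi) = \{g \in G : |\chi(g)| = \chi(1)\}$). The group $G$ is called nested if for all $\chi, \psi \in \mathrm{Irr}(G)$ either $Z(\chi) \le Z(\psi)$ or $Z(\psi) \le Z(\chi)$. The group $G$ is called a GVZ-group (generalized VZ-group) if $\chi(1)^2 = |G : Z(\chi)|$ for every $\chi \in \mathrm{Irr}(G)$. For $g \in G$, $\gamma_G(g)$ denotes the set $\{[g,x] : x \in G\}$, where $[g,x] = g^{-1}x^{-1}gx$ (it is only a subset of $G$; it is not assumed to be a subgroup). *)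

theory Defs
  imports
    "HOL-Algebra.Coset"
    "Jordan_Normal_Form.VS_Connect"
begin

definition mat_trace :: "complex mat \<Rightarrow> complex" where
  "mat_trace A = (\<Sum>i<dim_row A. A $$ (i, i))"

definition general_linear :: "nat \<Rightarrow> complex mat monoid" where
  "general_linear n = units_of (ring_mat TYPE(complex) n ())"

definition invariant_subspace ::
  "('a, 'b) monoid_scheme \<Rightarrow> nat \<Rightarrow> ('a \<Rightarrow> complex mat) \<Rightarrow> complex vec set \<Rightarrow> bool" where
  "invariant_subspace G n \<rho> W \<longleftrightarrow>
     subspace class_ring W (module_vec TYPE(complex) n) \<and>
     (\<forall>g\<in>carrier G. \<forall>w\<in>W. \<rho> g *\<^sub>v w \<in> W)"

definition irreducible_representation ::
  "('a, 'b) monoid_scheme \<Rightarrow> nat \<Rightarrow> ('a \<Rightarrow> complex mat) \<Rightarrow> bool" where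
  "irreducible_representation G n \<rho> \<longleftrightarrow>
     n > 0 \<and> \<rho> \<in> hom G (general_linear n) \<and>
     (\<forall>W. invariant_subspace G n \<rho> W \<longrightarrow> W = {0\<^sub>v n} \<or> W = carrier_vec n)"

text \<open>Characters are \<open>undefined\<close> outside \<open>carrier G\<close>, so that a character is determined
  by its values on the group.\<close>

definition character ::
  "('a, 'b) monoid_scheme \<Rightarrow> ('a \<Rightarrow> complex mat) \<Rightarrow> 'a \<Rightarrow> complex" where
  "character G \<rho> = (\<lambda>g\<in>carrier G. mat_trace (\<rho> g))"

definition Irr :: "('a, 'b) monoid_scheme \<Rightarrow> ('a \<Rightarrow> complex) set" where
  "Irr G = {character G \<rho> |n \<rho>. irreducible_representation G n \<rho>}"

text \<open>For the character of a representation of a finite group this is the kernel of the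
  representation.\<close>

definition char_kernel :: "('a, 'b) monoid_scheme \<Rightarrow> ('a \<Rightarrow> complex) \<Rightarrow> 'a set" where
  "char_kernel G \<chi> = {g \<in> carrier G. \<chi> g = \<chi> \<one>\<^bsub>G\<^esub>}"

definition group_center :: "('a, 'b) monoid_scheme \<Rightarrow> 'a set" where
  "group_center G = {z \<in> carrier G. \<forall>x\<in>carrier G. z \<otimes>\<^bsub>G\<^esub> x = x \<otimes>\<^bsub>G\<^esub> z}"

text \<open>The preimage in \<open>G\<close> of the center of \<open>G Mod char_kernel G \<chi>\<close>.\<close>

definition char_center :: "('a, 'b) monoid_scheme \<Rightarrow> ('a \<Rightarrow> complex) \<Rightarrow> 'a set" where
  "char_center G \<chi> =
     {g \<in> carrier G. char_kernel G \<chi> #>\<^bsub>G\<^esub> g \<in> group_center (G Mod char_kernel G \<chi>)}"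

definition nested_group :: "('a, 'b) monoid_scheme \<Rightarrow> bool" where
  "nested_group G \<longleftrightarrow>
     (\<forall>\<chi>\<in>Irr G. \<forall>\<psi>\<in>Irr G.
        char_center G \<chi> \<subseteq> char_center G \<psi> \<or> char_center G \<psi> \<subseteq> char_center G \<chi>)"

definition GVZ_group :: "('a, 'b) monoid_scheme \<Rightarrow> bool" where
  "GVZ_group G \<longleftrightarrow>
     (\<forall>\<chi>\<in>Irr G. (\<chi> \<one>\<^bsub>G\<^esub>)\<^sup>2 = of_nat (card (rcosets\<^bsub>G\<^esub> char_center G \<chi>)))"

definition commutator_elts :: "('a, 'b) monoid_scheme \<Rightarrow> 'a \<Rightarrow> 'a set" where
  "commutator_elts G g =
     {inv\<^bsub>G\<^esub> g \<otimes>\<^bsub>G\<^esub> inv\<^bsub>G\<^esub> x \<otimes>\<^bsub>G\<^esub> g \<otimes>\<^bsub>G\<^esub> x |x. x \<in> carrier G}"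

end

theory Submission
  imports
    Defs
    "Jordan_Normal_Form.Schur_Decomposition"
    "HOL-Algebra.Multiplicative_Group"
begin

text \<open>
  Write \<open>\<gamma>(g)\<close> for \<open>commutator_elts G g\<close>, so that \<open>g \<gamma>(g)\<close> is the conjugacy class of \<open>g\<close>.
  Two facts about an irreducible \<open>\<chi>\<close> carry the proof. First, \<open>g \<in> Z(\<chi>)\<close> iff
  \<open>\<gamma>(g) \<subseteq> ker \<chi>\<close>. Second, \<open>\<Sum>g. |\<chi> g|\<^sup>2 = |G|\<close> and \<open>|\<chi>| = \<chi>(1)\<close> on \<open>Z(\<chi>)\<close>, so that
  \<open>\<chi>(1)\<^sup>2 = |G : Z(\<chi>)|\<close> iff \<open>\<chi>\<close> vanishes off \<open>Z(\<chi>)\<close>.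

  Suppose that \<open>G\<close> is a nested GVZ-group and let \<open>N(g)\<close> be the intersection of the kernels of all
  \<open>\<chi>\<close> with \<open>g \<in> Z(\<chi>)\<close>. No irreducible character distinguishes the normalised indicator
  functions of the class of \<open>g\<close> and of the coset \<open>g N(g)\<close>: either \<open>N(g) \<subseteq> ker \<chi>\<close>, or
  \<open>\<chi>\<close> vanishes at \<open>g\<close> and sums to zero over the coset. As irreducible characters separate class
  functions, \<open>\<gamma>(g) = N(g)\<close>. Since the centers form a chain, so do the subgroups \<open>N(g)\<close>.

  Conversely, suppose that the sets \<open>\<gamma>(g)\<close> form a chain. Conjugate elements have \<open>\<gamma>\<close>-sets of
  equal size, so each \<open>\<gamma>(g)\<close> is invariant under conjugation; with
  \<open>[g, y] [g, x]\<^sup>y = [g, x y]\<close> it is a normal subgroup. If \<open>g \<notin> Z(\<chi>)\<close>, then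
  \<open>\<chi>\<close> sums to zero over \<open>g \<gamma>(g)\<close>, on which it is constant, whence \<open>\<chi>(g) = 0\<close>.
\<close>

section \<open>Matrices\<close>

text \<open>Matrices of all sizes share one type, so no single zero matrix can serve as the empty
  sum; the dimensions are passed explicitly instead.\<close>

definition mat_sum :: "nat \<Rightarrow> nat \<Rightarrow> ('a \<Rightarrow> complex mat) \<Rightarrow> 'a set \<Rightarrow> complex mat" where
  "mat_sum m n f A = mat m n (\<lambda>ij. \<Sum>x\<in>A. f x $$ ij)"

lemma mat_sum_carrier [simp]: "mat_sum m n f A \<in> carrier_mat m n"
  by (simp add: mat_sum_def)

lemma mat_sum_dim [simp]: "dim_row (mat_sum m n f A) = m" "dim_col (mat_sum m n f A) = n"
  by (simp_all add: mat_sum_def)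

lemma mat_sum_index [simp]:
  "i < m \<Longrightarrow> j < n \<Longrightarrow> mat_sum m n f A $$ (i, j) = (\<Sum>x\<in>A. f x $$ (i, j))"
  by (simp add: mat_sum_def)

lemma mat_sum_cong:
  "(\<And>x. x \<in> A \<Longrightarrow> f x = g x) \<Longrightarrow> mat_sum m n f A = mat_sum m n g A"
  by (simp add: mat_sum_def)

lemma mat_sum_reindex:
  assumes "bij_betw h A B"
  shows "mat_sum m n f B = mat_sum m n (\<lambda>x. f (h x)) A"
  unfolding mat_sum_def by (simp add: sum.reindex_bij_betw[OF assms, symmetric])

lemma mult_mat_sum:
  assumes "X \<in> carrier_mat l m" "\<And>x. x \<in> A \<Longrightarrow> f x \<in> carrier_mat m n"
  shows "X * mat_sum m n f A = mat_sum l n (\<lambda>x. X * f x) A"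
proof (rule eq_matI)
  fix i j assume ij: "i < dim_row (mat_sum l n (\<lambda>x. X * f x) A)"
    "j < dim_col (mat_sum l n (\<lambda>x. X * f x) A)"
  have "(X * f x) $$ (i, j) = (\<Sum>k<m. X $$ (i, k) * f x $$ (k, j))" if "x \<in> A" for x
  proof -
    have "f x \<in> carrier_mat m n" using assms that by blast
    then show ?thesis
      using ij assms(1) by (auto simp: scalar_prod_def atLeast0LessThan intro!: sum.cong)
  qed
  moreover have "(X * mat_sum m n f A) $$ (i, j) = (\<Sum>k<m. X $$ (i, k) * (\<Sum>x\<in>A. f x $$ (k, j)))"
    using ij assms by (auto simp: scalar_prod_def atLeast0LessThan intro!: sum.cong)
  ultimately show "(X * mat_sum m n f A) $$ (i, j) = mat_sum l n (\<lambda>x. X * f x) A $$ (i, j)"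
    using ij by (simp add: sum_distrib_left sum.swap[of _ A])
qed (use assms in auto)

lemma mat_sum_mult:
  assumes "X \<in> carrier_mat n l" "\<And>x. x \<in> A \<Longrightarrow> f x \<in> carrier_mat m n"
  shows "mat_sum m n f A * X = mat_sum m l (\<lambda>x. f x * X) A"
proof (rule eq_matI)
  fix i j assume ij: "i < dim_row (mat_sum m l (\<lambda>x. f x * X) A)"
    "j < dim_col (mat_sum m l (\<lambda>x. f x * X) A)"
  have "(f x * X) $$ (i, j) = (\<Sum>k<n. f x $$ (i, k) * X $$ (k, j))" if "x \<in> A" for x
  proof -
    have "f x \<in> carrier_mat m n" using assms that by blast
    then show ?thesis
      using ij assms(1) by (auto simp: scalar_prod_def atLeast0LessThan intro!: sum.cong)
  qed
  moreover have "(mat_sum m n f A * X) $$ (i, j) = (\<Sum>k<n. (\<Sum>x\<in>A. f x $$ (i, k)) * X $$ (k, j))"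
    using ij assms(1) by (auto simp: scalar_prod_def atLeast0LessThan intro!: sum.cong)
  ultimately show "(mat_sum m n f A * X) $$ (i, j) = mat_sum m l (\<lambda>x. f x * X) A $$ (i, j)"
    using ij by (simp add: sum_distrib_right sum.swap[of _ A])
qed (use assms in auto)

lemma mat_trace_mat_sum:
  assumes "\<And>x. x \<in> A \<Longrightarrow> f x \<in> carrier_mat n n"
  shows "mat_trace (mat_sum n n f A) = (\<Sum>x\<in>A. mat_trace (f x))"
proof -
  have "mat_trace (f x) = (\<Sum>i<n. f x $$ (i, i))" if "x \<in> A" for x
    using assms[OF that] by (simp add: mat_trace_def)
  then show ?thesis by (simp add: mat_trace_def sum.swap[of _ A])
qed

lemma mat_trace_mult_comm:
  assumes "A \<in> carrier_mat m n" "B \<in> carrier_mat n m"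
  shows "mat_trace (A * B) = mat_trace (B * A)"
proof -
  have "mat_trace (A * B) = (\<Sum>i<m. \<Sum>j<n. A $$ (i, j) * B $$ (j, i))"
    using assms by (auto simp: mat_trace_def scalar_prod_def atLeast0LessThan intro!: sum.cong)
  also have "\<dots> = (\<Sum>j<n. \<Sum>i<m. B $$ (j, i) * A $$ (i, j))"
    by (subst sum.swap) (simp add: mult.commute)
  also have "\<dots> = mat_trace (B * A)"
    using assms by (auto simp: mat_trace_def scalar_prod_def atLeast0LessThan intro!: sum.cong)
  finally show ?thesis .
qed

lemma mat_trace_smult: "mat_trace (c \<cdot>\<^sub>m A) = c * mat_trace A" if "A \<in> carrier_mat n n"
  using that by (simp add: mat_trace_def sum_distrib_left)

lemma mat_trace_one [simp]: "mat_trace (1\<^sub>m n) = of_nat n"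
  by (simp add: mat_trace_def)

lemma mat_trace_scalar: "mat_trace (c \<cdot>\<^sub>m 1\<^sub>m n) = c * of_nat n"
  by (simp add: mat_trace_def)

section \<open>Triangular matrices and matrices of finite order\<close>

lemma upper_triangular_mult:
  fixes A B :: "complex mat"
  assumes A: "A \<in> carrier_mat n n" and B: "B \<in> carrier_mat n n"
    and uA: "upper_triangular A" and uB: "upper_triangular B"
  shows "upper_triangular (A * B)"
    and "\<And>i. i < n \<Longrightarrow> (A * B) $$ (i, i) = A $$ (i, i) * B $$ (i, i)"
proof -
  have idx: "(A * B) $$ (i, j) = (\<Sum>k<n. A $$ (i, k) * B $$ (k, j))" if "i < n" "j < n" for i j
    using that A B by (auto simp: scalar_prod_def atLeast0LessThan intro!: sum.cong)
  have z: "A $$ (i, k) * B $$ (k, j) = 0" if "i < n" "k < n" "k < i \<or> j < k" for i j k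
    using that A B upper_triangularD[OF uA, of k i] upper_triangularD[OF uB, of j k] by auto
  show "upper_triangular (A * B)"
  proof (rule upper_triangularI)
    fix i j assume "j < i" "i < dim_row (A * B)"
    then show "(A * B) $$ (i, j) = 0"
      using A by (auto simp: idx intro!: sum.neutral z)
  qed
  fix i assume i: "i < n"
  have "(\<Sum>k<n. A $$ (i, k) * B $$ (k, i)) = (\<Sum>k\<in>{i}. A $$ (i, k) * B $$ (k, i))"
    using i by (intro sum.mono_neutral_right ballI z) auto
  then show "(A * B) $$ (i, i) = A $$ (i, i) * B $$ (i, i)" using i idx by simp
qed

lemma pow_mat_Suc_left:
  assumes "A \<in> carrier_mat n n"
  shows "A ^\<^sub>m Suc k = A * A ^\<^sub>m k"
proof (induction k)
  case (Suc k)
  then have "A ^\<^sub>m Suc (Suc k) = A * A ^\<^sub>m k * A" by simp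
  then show ?case using assms by (simp add: assoc_mult_mat[of _ n n _ n _ n])
qed (use assms in simp)

lemma upper_triangular_pow:
  fixes A :: "complex mat"
  assumes A: "A \<in> carrier_mat n n" and uA: "upper_triangular A"
  shows "upper_triangular (A ^\<^sub>m k)"
    and "\<And>i. i < n \<Longrightarrow> (A ^\<^sub>m k) $$ (i, i) = (A $$ (i, i)) ^ k"
proof -
  have "upper_triangular (A ^\<^sub>m k) \<and> (\<forall>i<n. (A ^\<^sub>m k) $$ (i, i) = (A $$ (i, i)) ^ k)"
  proof (induction k)
    case 0
    then show ?case using A by auto
  next
    case (Suc k)
    then show ?case
      using upper_triangular_mult[OF pow_carrier_mat[OF A] A _ uA, of k] by auto
  qed
  then show "upper_triangular (A ^\<^sub>m k)"
    and "\<And>i. i < n \<Longrightarrow> (A ^\<^sub>m k) $$ (i, i) = (A $$ (i, i)) ^ k" by auto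
qed

text \<open>Triangular form replaces diagonalisation: powers of a triangular matrix act entrywise on
  its diagonal, which therefore consists of roots of unity. This is enough for every statement about
  traces.\<close>

lemma finite_order_triangularization:
  fixes A :: "complex mat"
  assumes A: "A \<in> carrier_mat n n" and m: "A ^\<^sub>m m = 1\<^sub>m n"
  obtains T P Q where "similar_mat_wit A T P Q" "T \<in> carrier_mat n n" "upper_triangular T"
    "T ^\<^sub>m m = 1\<^sub>m n" "\<And>i. i < n \<Longrightarrow> T $$ (i, i) ^ m = 1"
proof -
  obtain es where "char_poly A = (\<Prod>a\<leftarrow>es. [:- a, 1:])"
    using char_poly_factorized[OF A] by blast
  then obtain T where T: "T \<in> carrier_mat n n" "upper_triangular T" "similar_mat A T"
    using schur_decomposition_exists[OF A] by blast
  then obtain P Q where w: "similar_mat_wit A T P Q" unfolding similar_mat_def by blast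
  note D = similar_mat_witD2[OF A w]
  have "T ^\<^sub>m m = Q * A ^\<^sub>m m * P"
    using similar_mat_wit_pow_id[OF similar_mat_wit_sym[OF w]] .
  then have Tm: "T ^\<^sub>m m = 1\<^sub>m n" using D m by simp
  moreover have "T $$ (i, i) ^ m = 1" if "i < n" for i
    using upper_triangular_pow(2)[OF T(1,2) that, of m] Tm that by simp
  ultimately show thesis using that w T by blast
qed

lemma mat_trace_similar:
  assumes "similar_mat_wit A T P Q"
  shows "mat_trace A = mat_trace T"
proof -
  define n where "n = dim_row A"
  note D = similar_mat_witD[OF n_def assms]
  have "mat_trace A = mat_trace (P * (T * Q))" using D by (simp add: assoc_mult_mat[of _ n n _ n _ n])
  also have "\<dots> = mat_trace (T * Q * P)" using D by (intro mat_trace_mult_comm[of _ n n]) auto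
  also have "T * Q * P = T" using D by (simp add: assoc_mult_mat[of _ n n _ n _ n])
  finally show ?thesis .
qed

lemma root_of_unity_cnj:
  fixes z :: complex
  assumes "z ^ m = 1" "m > 0"
  shows "z ^ (m - 1) = cnj z"
proof -
  have "norm z = 1" using assms by (metis power_eq_1_iff less_nat_zero_code)
  then have "z * cnj z = 1" by (simp add: complex_norm_square[symmetric])
  moreover have "z * z ^ (m - 1) = 1" using assms by (metis power_eq_if less_numeral_extra(3))
  ultimately show ?thesis
    by (metis mult_cancel_left mult_zero_left zero_neq_one)
qed

text \<open>Here \<open>A ^\<^sub>m (m - 1)\<close> is the inverse of \<open>A\<close>. Writing it
  as a power lets the triangular form of \<open>A\<close> serve both sides, and on roots of unity
  inversion is conjugation.\<close>

lemma mat_trace_finite_order_inverse: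
  fixes A :: "complex mat"
  assumes A: "A \<in> carrier_mat n n" and m: "A ^\<^sub>m m = 1\<^sub>m n" "m > 0"
  shows "mat_trace (A ^\<^sub>m (m - 1)) = cnj (mat_trace A)"
proof -
  obtain T P Q where w: "similar_mat_wit A T P Q" and T: "T \<in> carrier_mat n n" "upper_triangular T"
    and d: "\<And>i. i < n \<Longrightarrow> T $$ (i, i) ^ m = 1"
    using finite_order_triangularization[OF A m(1)] by metis
  have "mat_trace (A ^\<^sub>m (m - 1)) = mat_trace (T ^\<^sub>m (m - 1))"
    by (rule mat_trace_similar[OF similar_mat_wit_pow[OF w]])
  also have "\<dots> = (\<Sum>i<n. cnj (T $$ (i, i)))"
    using T upper_triangular_pow(2)[OF T] root_of_unity_cnj[OF d m(2)] by (simp add: mat_trace_def)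
  also have "\<dots> = cnj (mat_trace A)"
    using T mat_trace_similar[OF w] by (simp add: mat_trace_def)
  finally show ?thesis .
qed

text \<open>A triangular form \<open>T\<close> of \<open>A\<close> has ones on the diagonal, so \<open>1 + T + \<dots> + T ^ (m - 1)\<close> is
  invertible, while \<open>T\<close> fixes it under left multiplication.\<close>

lemma mat_trace_finite_order_eq_dim:
  fixes A :: "complex mat"
  assumes A: "A \<in> carrier_mat n n" and m: "A ^\<^sub>m m = 1\<^sub>m n" "m > 0"
    and tr: "mat_trace A = of_nat n"
  shows "A = 1\<^sub>m n"
proof -
  obtain T P Q where w: "similar_mat_wit A T P Q" and T: "T \<in> carrier_mat n n" "upper_triangular T"
    and Tm: "T ^\<^sub>m m = 1\<^sub>m n" and d: "\<And>i. i < n \<Longrightarrow> T $$ (i, i) ^ m = 1"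
    using finite_order_triangularization[OF A m(1)] by metis
  note D = similar_mat_witD2[OF A w]
  have nrm: "norm (T $$ (i, i)) = 1" if "i < n" for i
    using d[OF that] m(2) by (metis power_eq_1_iff less_nat_zero_code)
  have le: "Re (T $$ (i, i)) \<le> 1" if "i < n" for i
    using complex_Re_le_cmod[of "T $$ (i, i)"] nrm[OF that] by simp
  \<comment> \<open>The diagonal entries have modulus one and sum to \<open>n\<close>, so each real
    part must attain its maximum one, and then the imaginary part vanishes.\<close>
  have "(\<Sum>i<n. 1 - Re (T $$ (i, i))) = 0"
    using arg_cong[OF tr[unfolded mat_trace_similar[OF w]], of Re] T
    by (simp add: mat_trace_def sum_subtractf)
  then have "Re (T $$ (i, i)) = 1" if "i < n" for i
    using le that by (subst (asm) sum_nonneg_eq_0_iff) auto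
  then have dg: "T $$ (i, i) = 1" if "i < n" for i
    using nrm[OF that] that by (metis complex_eq_iff cmod_power2 one_complex.sel
      add_cancel_right_right power_eq_0_iff)
  define S where "S = mat_sum n n (\<lambda>k. T ^\<^sub>m k) {..<m}"
  have Pc: "T ^\<^sub>m k \<in> carrier_mat n n" for k using T by simp
  \<comment> \<open>Multiplication by \<open>T\<close> shifts the exponents cyclically modulo
    \<open>m\<close>. The inverse shift is written \<open>k + m - 1\<close> because
    \<open>k - 1\<close> would be truncated at \<open>k = 0\<close>.\<close>
  have bij: "bij_betw (\<lambda>k. (k + 1) mod m) {..<m} {..<m}"
  proof (rule bij_betwI[where g = "\<lambda>k. (k + m - 1) mod m"])
    show "((x + 1) mod m + m - 1) mod m = x" if "x \<in> {..<m}" for x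
      using that m(2) by (cases "x + 1 = m") auto
    show "((y + m - 1) mod m + 1) mod m = y" if "y \<in> {..<m}" for y
    proof (cases "y = 0")
      case False
      then have "(y + m - 1) mod m = (y - 1 + m) mod m" by (intro arg_cong[of _ _ "\<lambda>k. k mod m"]) simp
      also have "\<dots> = y - 1" unfolding mod_add_self2 using that by simp
      finally show ?thesis using that False by simp
    qed (use m in auto)
  qed (use m in auto)
  have "T * T ^\<^sub>m k = T ^\<^sub>m ((k + 1) mod m)" if "k < m" for k
  proof (cases "k + 1 = m")
    case True
    have "T * T ^\<^sub>m k = T ^\<^sub>m (k + 1)" using pow_mat_Suc_left[OF T(1), of k] by simp
    also have "\<dots> = T ^\<^sub>m ((k + 1) mod m)" using Tm T by (simp only: True mod_self pow_mat.simps) simp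
    finally show ?thesis .
  next
    case False
    then have "(k + 1) mod m = Suc k" using that by simp
    then show ?thesis by (simp only: pow_mat_Suc_left[OF T(1)])
  qed
  then have "T * S = S"
    unfolding S_def mult_mat_sum[OF T(1) Pc] 
    by (subst (2) mat_sum_reindex[OF bij]) (auto intro!: mat_sum_cong)
  moreover have "upper_triangular S"
    using upper_triangularD[OF upper_triangular_pow(1)[OF T]] T
    by (intro upper_triangularI) (auto simp: S_def intro!: sum.neutral)
  then have "det S = prod_list (diag_mat S)"
    using det_upper_triangular[of S n] by (simp add: S_def)
  \<comment> \<open>Every diagonal entry of \<open>S\<close> is a sum of \<open>m\<close>
    ones.\<close>
  then have "det S \<noteq> 0"
    using upper_triangular_pow(2)[OF T] dg m(2)
    by (auto simp: diag_mat_def prod_list_zero_iff S_def)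
  then obtain R where R: "R \<in> carrier_mat n n" "S * R = 1\<^sub>m n"
    using det_non_zero_imp_unit[of S n "()"] by (auto simp: Units_def ring_mat_simps S_def)
  ultimately have "T = 1\<^sub>m n"
    using T(1) assoc_mult_mat[of T n n S n R n] by (simp add: S_def)
  then show ?thesis using D by simp
qed

section \<open>Subspaces as ranges of injective matrices\<close>

lemma subspace_module_vec_iff:
  "VectorSpace.subspace class_ring W (module_vec TYPE(complex) n) \<longleftrightarrow>
     W \<subseteq> carrier_vec n \<and> 0\<^sub>v n \<in> W \<and> (\<forall>v\<in>W. \<forall>w\<in>W. v + w \<in> W) \<and> (\<forall>c. \<forall>v\<in>W. c \<cdot>\<^sub>v v \<in> W)"
  unfolding VectorSpace.subspace_def submodule_def
  using vec_vs[where ?'a = complex] vec_module[where ?'a = complex]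
  by (auto simp: module_vec_simps class_ring_simps)

lemma mult_mat_zero_vec: "A *\<^sub>v 0\<^sub>v n = 0\<^sub>v m" if "A \<in> carrier_mat m n"
  for A :: "complex mat"
  using that by (intro eq_vecI) (auto simp: scalar_prod_def)

lemma subspace_range:
  fixes A :: "complex mat"
  assumes A: "A \<in> carrier_mat m n"
    and W: "VectorSpace.subspace class_ring W (module_vec TYPE(complex) n)"
  shows "VectorSpace.subspace class_ring ((*\<^sub>v) A ` W) (module_vec TYPE(complex) m)"
  unfolding subspace_module_vec_iff
proof (intro conjI)
  note W' = W[unfolded subspace_module_vec_iff]
  show "(*\<^sub>v) A ` W \<subseteq> carrier_vec m" using A W' by auto
  show "0\<^sub>v m \<in> (*\<^sub>v) A ` W"
    using mult_mat_zero_vec[OF A, symmetric] W' by blast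
  show "\<forall>v\<in>(*\<^sub>v) A ` W. \<forall>w\<in>(*\<^sub>v) A ` W. v + w \<in> (*\<^sub>v) A ` W"
  proof clarify
    fix v w assume "v \<in> W" "w \<in> W"
    moreover from this have "v \<in> carrier_vec n" "w \<in> carrier_vec n" using W' by blast+
    then have "A *\<^sub>v v + A *\<^sub>v w = A *\<^sub>v (v + w)"
      by (rule mult_add_distrib_mat_vec[OF A, symmetric])
    ultimately show "A *\<^sub>v v + A *\<^sub>v w \<in> (*\<^sub>v) A ` W" using W' by auto
  qed
  show "\<forall>c. \<forall>v\<in>(*\<^sub>v) A ` W. c \<cdot>\<^sub>v v \<in> (*\<^sub>v) A ` W"
  proof clarify
    fix c v assume "v \<in> W"
    moreover from this have "c \<cdot>\<^sub>v (A *\<^sub>v v) = A *\<^sub>v (c \<cdot>\<^sub>v v)"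
      using mult_mat_vec[OF A] W' by auto
    ultimately show "c \<cdot>\<^sub>v (A *\<^sub>v v) \<in> (*\<^sub>v) A ` W" using W' by auto
  qed
qed

lemma subspace_carrier_vec: "VectorSpace.subspace class_ring (carrier_vec n) (module_vec TYPE(complex) n)"
  by (auto simp: subspace_module_vec_iff)

text \<open>Equivalently, the columns are linearly independent. Such matrices play the role of
  bases, the number of columns being the dimension.\<close>

definition injective_mat :: "complex mat \<Rightarrow> bool" where
  "injective_mat A \<longleftrightarrow>
     (\<forall>v\<in>carrier_vec (dim_col A). A *\<^sub>v v = 0\<^sub>v (dim_row A) \<longrightarrow> v = 0\<^sub>v (dim_col A))"

text \<open>If \<open>n > m\<close>, padding \<open>A\<close> with zero rows gives a singular square
  matrix \<open>C\<close>, and a nonzero vector killed by \<open>C\<close> is killed by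
  \<open>A\<close>. Row \<open>m\<close> is singled out in \<open>C\<close> to match the shape of
  \<open>det_row_0\<close>.\<close>

lemma injective_mat_le:
  assumes A: "A \<in> carrier_mat m n" and inj: "injective_mat A"
  shows "n \<le> m"
proof (rule ccontr)
  assume "\<not> n \<le> m"
  define C where "C = mat\<^sub>r n n (\<lambda>i. if i = m then 0\<^sub>v n else if i < m then row A i else 0\<^sub>v n)"
  have C: "C \<in> carrier_mat n n" by (simp add: C_def)
  have "det C = 0" unfolding C_def
    using \<open>\<not> n \<le> m\<close> A by (intro det_row_0) auto
  then obtain v where v: "v \<in> carrier_vec n" "v \<noteq> 0\<^sub>v n" "C *\<^sub>v v = 0\<^sub>v n"
    using det_0_iff_vec_prod_zero_field[OF C] by blast
  have "A *\<^sub>v v = 0\<^sub>v m"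
  proof (rule eq_vecI)
    fix i assume i: "i < dim_vec (0\<^sub>v m :: complex vec)"
    then have "(C *\<^sub>v v) $ i = (A *\<^sub>v v) $ i"
      using \<open>\<not> n \<le> m\<close> A by (simp add: C_def)
    then show "(A *\<^sub>v v) $ i = 0\<^sub>v m $ i" using v i \<open>\<not> n \<le> m\<close> by simp
  qed (use A in simp)
  then show False using inj v A by (auto simp: injective_mat_def)
qed

lemma injective_mat_cancel:
  assumes A: "A \<in> carrier_mat m n" "injective_mat A" and v: "v \<in> carrier_vec n" "w \<in> carrier_vec n"
    and eq: "A *\<^sub>v v = A *\<^sub>v w"
  shows "v = w"
proof -
  have "A *\<^sub>v (v - w) = 0\<^sub>v m"
    using mult_minus_distrib_mat_vec[OF A(1) v] eq A v by simp
  then have z: "v - w = 0\<^sub>v n" using A v by (auto simp: injective_mat_def)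
  show "v = w"
  proof (rule eq_vecI)
    fix i assume "i < dim_vec w"
    then show "v $ i = w $ i" using arg_cong[OF z, of "\<lambda>u. u $ i"] v by simp
  qed (use v in simp)
qed

lemma injective_mat_cancel_mat:
  assumes A: "A \<in> carrier_mat m n" "injective_mat A"
    and X: "X \<in> carrier_mat n k" "Y \<in> carrier_mat n k" and eq: "A * X = A * Y"
  shows "X = Y"
proof (rule mat_col_eqI)
  fix j assume "j < dim_col Y"
  then have j: "j < k" using X by simp
  have "A *\<^sub>v col X j = A *\<^sub>v col Y j"
    using col_mult2[OF A(1) X(1) j] col_mult2[OF A(1) X(2) j] eq by simp
  then show "col X j = col Y j"
    by (rule injective_mat_cancel[OF A, rotated -1]) (use X j in auto)
qed (use X in auto)

lemma injective_mat_mult: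
  assumes A: "A \<in> carrier_mat m n" "injective_mat A" and B: "B \<in> carrier_mat n k" "injective_mat B"
  shows "injective_mat (A * B)"
  unfolding injective_mat_def
proof (intro ballI impI)
  fix v assume "v \<in> carrier_vec (dim_col (A * B))" and z: "A * B *\<^sub>v v = 0\<^sub>v (dim_row (A * B))"
  then have v: "v \<in> carrier_vec k" using B by simp
  have "A *\<^sub>v (B *\<^sub>v v) = 0\<^sub>v m" using z A B v by (simp add: assoc_mult_mat_vec)
  then have "B *\<^sub>v v = 0\<^sub>v n" using A B v by (auto simp: injective_mat_def)
  then show "v = 0\<^sub>v (dim_col (A * B))" using B v by (auto simp: injective_mat_def)
qed

lemma injective_mat_surj:
  assumes A: "A \<in> carrier_mat n n" and inj: "injective_mat A" and w: "w \<in> carrier_vec n"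
  shows "w \<in> (*\<^sub>v) A ` carrier_vec n"
proof -
  have "det A \<noteq> 0"
    using det_0_iff_vec_prod_zero_field[OF A] inj A by (auto simp: injective_mat_def)
  then obtain R where R: "R \<in> carrier_mat n n" "A * R = 1\<^sub>m n"
    using det_non_zero_imp_unit[OF A, of "()"] by (auto simp: Units_def ring_mat_simps)
  then have "A *\<^sub>v (R *\<^sub>v w) = w"
    using A w assoc_mult_mat_vec[OF A R(1) w] by simp
  then show ?thesis using R w by (metis image_eqI mult_mat_vec_carrier)
qed

lemma factor_through_range:
  fixes A :: "complex mat"
  assumes A: "A \<in> carrier_mat m n" and C: "C \<in> carrier_mat m k"
    and cols: "\<And>j. j < k \<Longrightarrow> col C j \<in> (*\<^sub>v) A ` carrier_vec n"
  obtains X where "X \<in> carrier_mat n k" "C = A * X"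
proof -
  have "\<forall>j. \<exists>v. j < k \<longrightarrow> v \<in> carrier_vec n \<and> col C j = A *\<^sub>v v"
    using cols by blast
  from choice[OF this]
  obtain x where x: "\<And>j. j < k \<Longrightarrow> x j \<in> carrier_vec n \<and> col C j = A *\<^sub>v x j"
    by blast
  define X where "X = mat n k (\<lambda>(i, j). x j $ i)"
  have X: "X \<in> carrier_mat n k" by (simp add: X_def)
  have "col X j = x j" if "j < k" for j
    using x[OF that] that by (intro eq_vecI) (auto simp: X_def)
  then have "C = A * X"
    using x X C A by (intro mat_col_eqI) (auto simp: col_mult2[OF A X])
  then show thesis using X that by blast
qed

text \<open>Extension of an independent family by one vector outside its span: in a relation among
  the new columns, a nonzero coefficient at \<open>u\<close> would express \<open>u\<close> by the
  old ones.\<close>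

lemma injective_mat_append_col:
  assumes A: "A \<in> carrier_mat m k" and inj: "injective_mat A"
    and W: "VectorSpace.subspace class_ring W (module_vec TYPE(complex) m)" and AW: "(*\<^sub>v) A ` carrier_vec k \<subseteq> W"
    and u: "u \<in> W" "u \<notin> (*\<^sub>v) A ` carrier_vec k"
  obtains B where "B \<in> carrier_mat m (Suc k)" "injective_mat B" "(*\<^sub>v) B ` carrier_vec (Suc k) \<subseteq> W"
proof -
  note W' = W[unfolded subspace_module_vec_iff]
  have uc: "u \<in> carrier_vec m" using u W' by blast
  define B where "B = mat m (Suc k) (\<lambda>(i, j). if j < k then A $$ (i, j) else u $ i)"
  have B: "B \<in> carrier_mat m (Suc k)" by (simp add: B_def)
  have Bv: "B *\<^sub>v v = A *\<^sub>v vec_first v k + v $ k \<cdot>\<^sub>v u" if v: "v \<in> carrier_vec (Suc k)" for v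
  proof (rule eq_vecI)
    fix i assume "i < dim_vec (A *\<^sub>v vec_first v k + v $ k \<cdot>\<^sub>v u)"
    then have i: "i < m" using uc by simp
    have "(B *\<^sub>v v) $ i = (\<Sum>j<Suc k. B $$ (i, j) * v $ j)"
      using i v B by (auto simp: scalar_prod_def atLeast0LessThan intro!: sum.cong)
    also have "\<dots> = (\<Sum>j<k. A $$ (i, j) * v $ j) + u $ i * v $ k"
      using i by (simp add: B_def)
    also have "(\<Sum>j<k. A $$ (i, j) * v $ j) = (A *\<^sub>v vec_first v k) $ i"
      using i v A by (auto simp: scalar_prod_def vec_first_def atLeast0LessThan intro!: sum.cong)
    finally show "(B *\<^sub>v v) $ i = (A *\<^sub>v vec_first v k + v $ k \<cdot>\<^sub>v u) $ i"
      using i uc A by simp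
  qed (use B uc in simp)
  have vf: "vec_first v k \<in> carrier_vec k" for v :: "complex vec" by (simp add: vec_first_def)
  have "(*\<^sub>v) B ` carrier_vec (Suc k) \<subseteq> W"
    using Bv AW vf u W' by (auto simp: image_subset_iff)
  moreover have "injective_mat B"
    unfolding injective_mat_def
  proof (intro ballI impI)
    fix v assume "v \<in> carrier_vec (dim_col B)" "B *\<^sub>v v = 0\<^sub>v (dim_row B)"
    then have v: "v \<in> carrier_vec (Suc k)" and z: "A *\<^sub>v vec_first v k + v $ k \<cdot>\<^sub>v u = 0\<^sub>v m"
      using B Bv by auto
    have "v $ k = 0"
    proof (rule ccontr)
      assume n: "v $ k \<noteq> 0"
      have "u = A *\<^sub>v ((- inverse (v $ k)) \<cdot>\<^sub>v vec_first v k)"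
      proof (rule eq_vecI)
        fix i assume "i < dim_vec (A *\<^sub>v ((- inverse (v $ k)) \<cdot>\<^sub>v vec_first v k))"
        then have i: "i < m" using A by simp
        then have "(A *\<^sub>v vec_first v k) $ i + v $ k * u $ i = 0"
          using arg_cong[OF z, of "\<lambda>w. w $ i"] A uc by simp
        then have "u $ i = - inverse (v $ k) * (A *\<^sub>v vec_first v k) $ i"
          using n by (simp add: field_simps eq_neg_iff_add_eq_0)
        also have "\<dots> = ((- inverse (v $ k)) \<cdot>\<^sub>v (A *\<^sub>v vec_first v k)) $ i" using i A by simp
        finally show "u $ i = (A *\<^sub>v ((- inverse (v $ k)) \<cdot>\<^sub>v vec_first v k)) $ i"
          by (simp only: mult_mat_vec[OF A vf])
      qed (use uc A in simp)
      then show False using u(2) vf by (metis image_eqI smult_carrier_vec)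
    qed
    moreover have "0 \<cdot>\<^sub>v u = 0\<^sub>v m" using uc by (intro eq_vecI) auto
    ultimately have "A *\<^sub>v vec_first v k = 0\<^sub>v m"
      using z right_zero_vec[OF mult_mat_vec_carrier[OF A vf]] by simp
    then have "vec_first v k = 0\<^sub>v k" using inj A vf by (auto simp: injective_mat_def)
    then have "vec_first v k $ i = 0" if "i < k" for i using that by simp
    then have "v $ i = 0" if "i < k" for i using that by (simp add: vec_first_def)
    with \<open>v $ k = 0\<close> show "v = 0\<^sub>v (dim_col B)"
      using v B by (intro eq_vecI) (auto simp: less_Suc_eq)
  qed
  ultimately show thesis using B that by blast
qed

text \<open>Take an injective matrix with range inside \<open>W\<close> and as many columns as
  possible; \<open>injective_mat_le\<close> bounds this number by \<open>n\<close>. A vector of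
  \<open>W\<close> outside the range would allow one more column.\<close>

lemma subspace_eq_range:
  assumes W: "VectorSpace.subspace class_ring W (module_vec TYPE(complex) n)"
  obtains k B where "B \<in> carrier_mat n k" "injective_mat B" "W = (*\<^sub>v) B ` carrier_vec k"
proof -
  note W' = W[unfolded subspace_module_vec_iff]
  define Q where "Q k \<longleftrightarrow>
    (\<exists>B\<in>carrier_mat n k. injective_mat B \<and> (*\<^sub>v) B ` carrier_vec k \<subseteq> W)" for k
  have "Q 0" unfolding Q_def
  proof (intro bexI[of _ "0\<^sub>m n 0"] conjI image_subsetI)
    fix v :: "complex vec" assume "v \<in> carrier_vec 0"
    then have "0\<^sub>m n 0 *\<^sub>v v = 0\<^sub>v n" by (intro eq_vecI) (auto simp: scalar_prod_def)
    then show "0\<^sub>m n 0 *\<^sub>v v \<in> W" using W' by simp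
  qed (auto simp: injective_mat_def)
  moreover have "k \<le> n" if "Q k" for k
    using that injective_mat_le by (auto simp: Q_def)
  ultimately obtain k where k: "Q k" "\<And>l. Q l \<Longrightarrow> l \<le> k"
    using Nat.ex_has_greatest_nat[of Q 0 n] by blast
  then obtain B where B: "B \<in> carrier_mat n k" "injective_mat B" "(*\<^sub>v) B ` carrier_vec k \<subseteq> W"
    by (auto simp: Q_def)
  have "u \<in> (*\<^sub>v) B ` carrier_vec k" if "u \<in> W" for u
  proof (rule ccontr)
    assume "u \<notin> (*\<^sub>v) B ` carrier_vec k"
    then have "Q (Suc k)"
      using injective_mat_append_col[OF B(1,2) W B(3) that] unfolding Q_def by metis
    then show False using k(2) by fastforce
  qed
  then show thesis using that B by blast
qed

section \<open>Matrix representations of finite groups\<close>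

context group
begin

lemma bij_betw_conjugation:
  assumes "g \<in> carrier G"
  shows "bij_betw (\<lambda>x. g \<otimes> x \<otimes> inv g) (carrier G) (carrier G)"
  by (rule bij_betwI[where g = "\<lambda>x. inv g \<otimes> x \<otimes> g"]) (use assms in \<open>auto simp: m_assoc m_assoc[of "inv g" g, symmetric] m_assoc[of g "inv g", symmetric]\<close>)

text \<open>Expressing inverses as powers gives the traces at inverses, and makes multiplicatively
  closed subsets containing the identity subgroups.\<close>

lemma inv_eq_pow_card:
  assumes "finite (carrier G)" "g \<in> carrier G"
  shows "inv g = g [^] (card (carrier G) - 1)"
proof -
  have "card (carrier G) > 0" using assms by (auto simp: card_gt_0_iff)
  then have "g [^] (card (carrier G) - 1) \<otimes> g = \<one>"
    using nat_pow_Suc[of g "card (carrier G) - 1"] pow_order_eq_1[OF assms(2)]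
    by (simp add: Coset.order_def)
  then show ?thesis using assms by (intro inv_equality) auto
qed

lemma bij_betw_left_translation:
  assumes "g \<in> carrier G"
  shows "bij_betw (\<lambda>x. g \<otimes> x) (carrier G) (carrier G)"
  by (rule bij_betwI[where g = "\<lambda>x. inv g \<otimes> x"]) (use assms in \<open>auto simp: m_assoc[symmetric]\<close>)

end

lemma group_general_linear: "group (general_linear n)"
proof -
  interpret R: ring "ring_mat TYPE(complex) n ()" by (rule ring_mat)
  show ?thesis unfolding general_linear_def by (rule R.units_group)
qed

lemma carrier_general_linear:
  "carrier (general_linear n) = {A \<in> carrier_mat n n. \<exists>B\<in>carrier_mat n n. B * A = 1\<^sub>m n \<and> A * B = 1\<^sub>m n}"
  by (auto simp: general_linear_def units_of_def Units_def ring_mat_simps)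

lemma mult_general_linear: "A \<otimes>\<^bsub>general_linear n\<^esub> B = A * B"
  by (simp add: general_linear_def units_of_def ring_mat_simps)

lemma one_general_linear: "\<one>\<^bsub>general_linear n\<^esub> = 1\<^sub>m n"
  by (simp add: general_linear_def units_of_def ring_mat_simps)

text \<open>Invertibility of the matrices need not be assumed: it follows from the multiplication
  rule applied to a group element and its inverse.\<close>

locale matrix_representation = group G for G (structure) +
  fixes n :: nat and \<rho> :: "'a \<Rightarrow> complex mat"
  assumes finite_carrier: "finite (carrier G)"
    and rep_carrier: "g \<in> carrier G \<Longrightarrow> \<rho> g \<in> carrier_mat n n"
    and rep_mult: "g \<in> carrier G \<Longrightarrow> h \<in> carrier G \<Longrightarrow> \<rho> (g \<otimes> h) = \<rho> g * \<rho> h"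
    and rep_one: "\<rho> \<one> = 1\<^sub>m n"
begin

lemma rep_inv:
  assumes "g \<in> carrier G"
  shows "\<rho> (inv g) * \<rho> g = 1\<^sub>m n" "\<rho> g * \<rho> (inv g) = 1\<^sub>m n"
  using assms rep_mult[of "inv g" g] rep_mult[of g "inv g"] rep_one by simp_all

lemma rep_hom: "\<rho> \<in> hom G (general_linear n)"
proof (rule homI)
  fix g assume g: "g \<in> carrier G"
  then show "\<rho> g \<in> carrier (general_linear n)"
    using rep_inv[OF g] rep_carrier[of "inv g"] rep_carrier[OF g] by (auto simp: carrier_general_linear)
qed (simp add: rep_mult mult_general_linear)

lemma rep_dim [simp]:
  "g \<in> carrier G \<Longrightarrow> dim_row (\<rho> g) = n" "g \<in> carrier G \<Longrightarrow> dim_col (\<rho> g) = n"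
  using rep_carrier by auto

lemma rep_pow: "g \<in> carrier G \<Longrightarrow> \<rho> (g [^] (k :: nat)) = \<rho> g ^\<^sub>m k"
  by (induction k) (simp_all add: rep_one rep_mult)

lemma rep_order: "g \<in> carrier G \<Longrightarrow> \<rho> g ^\<^sub>m card (carrier G) = 1\<^sub>m n"
  using rep_pow[of g "card (carrier G)"] pow_order_eq_1[of g] rep_one by (simp add: Coset.order_def)

lemma order_pos: "card (carrier G) > 0"
  using finite_carrier one_closed card_gt_0_iff by blast

text \<open>The image of the group algebra element with coefficients \<open>f\<close>. It is central
  in the image when \<open>f\<close> is a class function.\<close>

definition class_sum :: "('a \<Rightarrow> complex) \<Rightarrow> complex mat" where
  "class_sum f = mat_sum n n (\<lambda>x. f x \<cdot>\<^sub>m \<rho> x) (carrier G)"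

lemma class_sum_carrier [simp]: "class_sum f \<in> carrier_mat n n"
  by (simp add: class_sum_def)

lemma mult_class_sum:
  assumes "X \<in> carrier_mat m n"
  shows "X * class_sum f = mat_sum m n (\<lambda>x. f x \<cdot>\<^sub>m (X * \<rho> x)) (carrier G)"
proof -
  have "X * class_sum f = mat_sum m n (\<lambda>x. X * (f x \<cdot>\<^sub>m \<rho> x)) (carrier G)"
    unfolding class_sum_def using rep_carrier by (intro mult_mat_sum[OF assms]) auto
  also have "\<dots> = mat_sum m n (\<lambda>x. f x \<cdot>\<^sub>m (X * \<rho> x)) (carrier G)"
    using assms rep_carrier by (intro mat_sum_cong mult_smult_distrib) auto
  finally show ?thesis .
qed

lemma class_sum_mult:
  assumes "X \<in> carrier_mat n m"
  shows "class_sum f * X = mat_sum n m (\<lambda>x. f x \<cdot>\<^sub>m (\<rho> x * X)) (carrier G)"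
proof -
  have "class_sum f * X = mat_sum n m (\<lambda>x. (f x \<cdot>\<^sub>m \<rho> x) * X) (carrier G)"
    unfolding class_sum_def using rep_carrier by (intro mat_sum_mult[OF assms]) auto
  also have "\<dots> = mat_sum n m (\<lambda>x. f x \<cdot>\<^sub>m (\<rho> x * X)) (carrier G)"
    using assms rep_carrier by (intro mat_sum_cong mult_smult_assoc_mat) auto
  finally show ?thesis .
qed

text \<open>Substituting \<open>g x g^-1\<close> for \<open>x\<close> moves \<open>\<rho> g\<close>
  to the other side without changing the coefficients. The hypothesis on \<open>f\<close> is
  constancy on conjugacy classes, written without inverses.\<close>

lemma class_sum_commutes:
  assumes f: "\<And>x y. x \<in> carrier G \<Longrightarrow> y \<in> carrier G \<Longrightarrow> f (x \<otimes> y) = f (y \<otimes> x)"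
    and g: "g \<in> carrier G"
  shows "class_sum f * \<rho> g = \<rho> g * class_sum f"
proof -
  have "class_sum f * \<rho> g = mat_sum n n (\<lambda>x. f x \<cdot>\<^sub>m (\<rho> x * \<rho> g)) (carrier G)"
    by (rule class_sum_mult[OF rep_carrier[OF g]])
  also have "\<dots> = mat_sum n n (\<lambda>x. f (g \<otimes> x \<otimes> inv g) \<cdot>\<^sub>m (\<rho> (g \<otimes> x \<otimes> inv g) * \<rho> g)) (carrier G)"
    by (rule mat_sum_reindex[OF bij_betw_conjugation[OF g]])
  also have "\<dots> = mat_sum n n (\<lambda>x. f x \<cdot>\<^sub>m (\<rho> g * \<rho> x)) (carrier G)"
  proof (rule mat_sum_cong)
    fix x assume x: "x \<in> carrier G"
    have "f (g \<otimes> x \<otimes> inv g) = f x"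
      using f[of "g \<otimes> x" "inv g"] g x by (simp add: m_assoc[symmetric])
    moreover have "\<rho> (g \<otimes> x \<otimes> inv g) * \<rho> g = \<rho> g * \<rho> x"
      using g x rep_mult[of "g \<otimes> x \<otimes> inv g" g] rep_mult[of g x] by (simp add: m_assoc)
    ultimately show "f (g \<otimes> x \<otimes> inv g) \<cdot>\<^sub>m (\<rho> (g \<otimes> x \<otimes> inv g) * \<rho> g) = f x \<cdot>\<^sub>m (\<rho> g * \<rho> x)"
      by simp
  qed
  also have "\<dots> = \<rho> g * class_sum f"
    by (rule mult_class_sum[OF rep_carrier[OF g], symmetric])
  finally show ?thesis .
qed

lemma mat_trace_class_sum:
  "mat_trace (class_sum f) = (\<Sum>x\<in>carrier G. f x * mat_trace (\<rho> x))"
proof -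
  have "mat_trace (class_sum f) = (\<Sum>x\<in>carrier G. mat_trace (f x \<cdot>\<^sub>m \<rho> x))"
    unfolding class_sum_def using rep_carrier by (intro mat_trace_mat_sum) auto
  also have "\<dots> = (\<Sum>x\<in>carrier G. f x * mat_trace (\<rho> x))"
    using rep_carrier mat_trace_smult by (intro sum.cong) auto
  finally show ?thesis .
qed

lemma mat_trace_rep_inv:
  assumes "g \<in> carrier G"
  shows "mat_trace (\<rho> (inv g)) = cnj (mat_trace (\<rho> g))"
proof -
  have "inv g = g [^] (card (carrier G) - 1)" by (rule inv_eq_pow_card[OF finite_carrier assms])
  then show ?thesis
    using mat_trace_finite_order_inverse[OF rep_carrier rep_order order_pos] rep_pow assms by simp
qed

text \<open>Among matrices of finite order only the identity has trace \<open>n\<close>, so the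
  kernel read off from the character is that of the representation.\<close>

lemma char_kernel_character:
  "char_kernel G (character G \<rho>) = {g \<in> carrier G. \<rho> g = 1\<^sub>m n}"
proof -
  have "\<rho> g = 1\<^sub>m n \<longleftrightarrow> mat_trace (\<rho> g) = of_nat n" if "g \<in> carrier G" for g
    using mat_trace_finite_order_eq_dim[OF rep_carrier rep_order order_pos, OF that that] by auto
  then show ?thesis by (auto simp: char_kernel_def character_def rep_one)
qed

lemma invariant_subspace_range:
  assumes X: "X \<in> carrier_mat n n" and comm: "\<And>g. g \<in> carrier G \<Longrightarrow> X * \<rho> g = \<rho> g * X"
  shows "invariant_subspace G n \<rho> ((*\<^sub>v) X ` carrier_vec n)"
  unfolding invariant_subspace_def
proof (intro conjI ballI)
  show "VectorSpace.subspace class_ring ((*\<^sub>v) X ` carrier_vec n) (module_vec TYPE(complex) n)"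
    by (rule subspace_range[OF X subspace_carrier_vec])
  fix g w assume g: "g \<in> carrier G" and "w \<in> (*\<^sub>v) X ` carrier_vec n"
  then obtain v where v: "v \<in> carrier_vec n" "w = X *\<^sub>v v" by blast
  have "\<rho> g *\<^sub>v w = X *\<^sub>v (\<rho> g *\<^sub>v v)"
    using v assoc_mult_mat_vec[OF X rep_carrier[OF g] v(1)] assoc_mult_mat_vec[OF rep_carrier[OF g] X v(1)]
      comm[OF g] by simp
  then show "\<rho> g *\<^sub>v w \<in> (*\<^sub>v) X ` carrier_vec n"
    using rep_carrier[OF g] v by (metis image_eqI mult_mat_vec_carrier)
qed

end

section \<open>Schur's lemma\<close>

locale irreducible_matrix_representation = matrix_representation +
  assumes dim_pos: "n > 0"
    and irreducible: "invariant_subspace G n \<rho> W \<Longrightarrow> W = {0\<^sub>v n} \<or> W = carrier_vec n"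
begin

text \<open>As \<open>n > 0\<close>, \<open>X\<close> has a complex eigenvalue \<open>c\<close>. Its
  eigenspace is invariant because \<open>X\<close> commutes with the representation, and it is
  nonzero, so it is the whole space.\<close>

lemma schur:
  assumes X: "X \<in> carrier_mat n n" and comm: "\<And>g. g \<in> carrier G \<Longrightarrow> X * \<rho> g = \<rho> g * X"
  obtains c where "X = c \<cdot>\<^sub>m 1\<^sub>m n"
proof -
  obtain as where as: "char_poly X = (\<Prod>a\<leftarrow>as. [:- a, 1:])" "length as = n"
    using char_poly_factorized[OF X] by blast
  then obtain c bs where "as = c # bs" using dim_pos by (cases as) auto
  then have "poly (char_poly X) c = 0" using as by simp
  then have "eigenvalue X c" using eigenvalue_root_char_poly[OF X] by simp
  then obtain v where v: "v \<in> carrier_vec n" "v \<noteq> 0\<^sub>v n" "X *\<^sub>v v = c \<cdot>\<^sub>v v"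
    using X by (auto simp: eigenvalue_def eigenvector_def)
  define W where "W = {v \<in> carrier_vec n. X *\<^sub>v v = c \<cdot>\<^sub>v v}"
  have "invariant_subspace G n \<rho> W"
    unfolding invariant_subspace_def subspace_module_vec_iff
  proof (intro conjI ballI allI)
    have "c \<cdot>\<^sub>v 0\<^sub>v n = 0\<^sub>v n" by (intro eq_vecI) auto
    then show "0\<^sub>v n \<in> W" using mult_mat_zero_vec[OF X] by (simp add: W_def)
    show "v + w \<in> W" if "v \<in> W" "w \<in> W" for v w
    proof -
      have vw: "v \<in> carrier_vec n" "w \<in> carrier_vec n" using that by (auto simp: W_def)
      show ?thesis
        using that mult_add_distrib_mat_vec[OF X vw] smult_add_distrib_vec[OF vw, of c]
        by (simp add: W_def)
    qed
    show "a \<cdot>\<^sub>v v \<in> W" if "v \<in> W" for a v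
    proof -
      have v: "v \<in> carrier_vec n" "X *\<^sub>v v = c \<cdot>\<^sub>v v" using that by (auto simp: W_def)
      then show ?thesis
        using mult_mat_vec[OF X v(1), of a] by (simp add: W_def smult_smult_assoc mult.commute)
    qed
    show "\<rho> g *\<^sub>v v \<in> W" if "g \<in> carrier G" "v \<in> W" for g v
    proof -
      have v: "v \<in> carrier_vec n" "X *\<^sub>v v = c \<cdot>\<^sub>v v" using that by (auto simp: W_def)
      note g = rep_carrier[OF that(1)]
      have "X *\<^sub>v (\<rho> g *\<^sub>v v) = \<rho> g *\<^sub>v (X *\<^sub>v v)"
        using comm[OF that(1)] assoc_mult_mat_vec[OF X g v(1)] assoc_mult_mat_vec[OF g X v(1)] by simp
      then show ?thesis using v g mult_mat_vec[OF g v(1), of c] by (simp add: W_def)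
    qed
  qed (auto simp: W_def)
  with irreducible v have W: "W = carrier_vec n" by (auto simp: W_def)
  have "X = c \<cdot>\<^sub>m 1\<^sub>m n"
  proof (rule mat_col_eqI)
    fix j assume "j < dim_col (c \<cdot>\<^sub>m 1\<^sub>m n)"
    then have j: "j < n" by simp
    have "unit_vec n j \<in> W" using W by simp
    then have "X *\<^sub>v unit_vec n j = c \<cdot>\<^sub>v unit_vec n j" by (simp add: W_def)
    moreover have "X *\<^sub>v unit_vec n j = col X j" using col_mult2[OF X one_carrier_mat j] X j by simp
    ultimately show "col X j = col (c \<cdot>\<^sub>m 1\<^sub>m n) j" using j by simp
  qed (use X in auto)
  then show thesis by (rule that)
qed

lemma mat_trace_schur:
  assumes X: "X \<in> carrier_mat n n" and comm: "\<And>g. g \<in> carrier G \<Longrightarrow> X * \<rho> g = \<rho> g * X"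
  shows "X = (mat_trace X / of_nat n) \<cdot>\<^sub>m 1\<^sub>m n"
proof -
  obtain c where c: "X = c \<cdot>\<^sub>m 1\<^sub>m n" using schur[OF X comm] by blast
  then show ?thesis using dim_pos by (simp add: mat_trace_scalar)
qed

text \<open>The sum in the hypothesis is the trace of \<open>class_sum f\<close>, which is scalar by
  Schur's lemma.\<close>

lemma class_sum_eq_zero:
  assumes f: "\<And>x y. x \<in> carrier G \<Longrightarrow> y \<in> carrier G \<Longrightarrow> f (x \<otimes> y) = f (y \<otimes> x)"
    and "(\<Sum>x\<in>carrier G. f x * character G \<rho> x) = 0"
  shows "class_sum f = 0\<^sub>m n n"
proof -
  have "class_sum f = (mat_trace (class_sum f) / of_nat n) \<cdot>\<^sub>m 1\<^sub>m n"
    by (rule mat_trace_schur[OF class_sum_carrier class_sum_commutes[of f, OF f]])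
  also have "mat_trace (class_sum f) = 0"
    using assms(2) by (simp add: mat_trace_class_sum character_def)
  also have "(0 / of_nat n :: complex) \<cdot>\<^sub>m 1\<^sub>m n = 0\<^sub>m n n" by (intro eq_matI) auto
  finally show ?thesis .
qed

end

section \<open>Irreducible subrepresentations and characters\<close>

lemma irreducible_representation_iff:
  fixes G :: "('a, 'b) monoid_scheme"
  assumes G: "group G" "finite (carrier G)"
  shows "irreducible_representation G n \<rho> \<longleftrightarrow> irreducible_matrix_representation G n \<rho>"
proof
  assume irr: "irreducible_representation G n \<rho>"
  then have hom: "\<rho> \<in> hom G (general_linear n)" by (simp add: irreducible_representation_def)
  interpret group G by (rule G)
  show "irreducible_matrix_representation G n \<rho>"
  proof
    show "\<rho> \<one>\<^bsub>G\<^esub> = 1\<^sub>m n"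
      using hom_one[OF hom G(1) group_general_linear] by (simp add: one_general_linear)
    show "\<rho> g \<in> carrier_mat n n" if "g \<in> carrier G" for g
      using hom that by (auto simp: hom_def Pi_iff carrier_general_linear)
    show "\<rho> (g \<otimes>\<^bsub>G\<^esub> h) = \<rho> g * \<rho> h" if "g \<in> carrier G" "h \<in> carrier G" for g h
      using hom_mult[OF hom that] by (simp add: mult_general_linear)
  qed (use G irr in \<open>auto simp: irreducible_representation_def\<close>)
next
  assume "irreducible_matrix_representation G n \<rho>"
  then interpret irreducible_matrix_representation G n \<rho> .
  show "irreducible_representation G n \<rho>"
    using dim_pos rep_hom irreducible by (auto simp: irreducible_representation_def)
qed

lemma IrrE:
  assumes "group G" "finite (carrier G)" "\<chi> \<in> Irr G"
  obtains n \<rho> where "irreducible_matrix_representation G n \<rho>" "\<chi> = character G \<rho>"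
  using assms by (auto simp: Irr_def irreducible_representation_iff)

lemma character_in_Irr:
  assumes "irreducible_matrix_representation G n \<rho>"
  shows "character G \<rho> \<in> Irr G"
proof -
  interpret irreducible_matrix_representation G n \<rho> by fact
  show ?thesis
    using assms irreducible_representation_iff[OF group_axioms finite_carrier] by (auto simp: Irr_def)
qed

section \<open>Existence of irreducible subrepresentations\<close>

context matrix_representation
begin

text \<open>An invariant subspace is recorded through a basis matrix, so that the action on it can
  be written in coordinates.\<close>

definition invariant_range :: "nat \<Rightarrow> complex mat \<Rightarrow> bool" where
  "invariant_range k B \<longleftrightarrow> B \<in> carrier_mat n k \<and> injective_mat B \<and>
     (\<forall>g\<in>carrier G. \<forall>v\<in>carrier_vec k. \<rho> g *\<^sub>v (B *\<^sub>v v) \<in> (*\<^sub>v) B ` carrier_vec k)"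

text \<open>The matrix \<open>\<sigma> g\<close> describes the action of \<open>\<rho> g\<close> in
  the basis formed by the columns of \<open>B\<close>. Cancelling the injective \<open>B\<close>
  transfers the representation laws from \<open>\<rho>\<close> to \<open>\<sigma>\<close>.\<close>

lemma invariant_rangeE:
  assumes "invariant_range k B"
  obtains \<sigma> where "matrix_representation G k \<sigma>" "\<And>g. g \<in> carrier G \<Longrightarrow> \<rho> g * B = B * \<sigma> g"
proof -
  have B: "B \<in> carrier_mat n k" "injective_mat B"
    and inv: "\<And>g v. g \<in> carrier G \<Longrightarrow> v \<in> carrier_vec k \<Longrightarrow> \<rho> g *\<^sub>v (B *\<^sub>v v) \<in> (*\<^sub>v) B ` carrier_vec k"
    using assms by (auto simp: invariant_range_def)
  have "\<exists>X. X \<in> carrier_mat k k \<and> \<rho> g * B = B * X" if g: "g \<in> carrier G" for g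
  proof -
    have "col (\<rho> g * B) j \<in> (*\<^sub>v) B ` carrier_vec k" if j: "j < k" for j
    proof -
      have "col (\<rho> g * B) j = \<rho> g *\<^sub>v (B *\<^sub>v unit_vec k j)"
        using col_mult2[OF rep_carrier[OF g] B(1) j] col_mult2[OF B(1) one_carrier_mat j] B j by simp
      then show ?thesis using inv[OF g, of "unit_vec k j"] by simp
    qed
    then show ?thesis
      using factor_through_range[OF B(1) mult_carrier_mat[OF rep_carrier[OF g] B(1)]] by blast
  qed
  then have "\<forall>g\<in>carrier G. \<exists>X. X \<in> carrier_mat k k \<and> \<rho> g * B = B * X" by blast
  from bchoice[OF this] obtain \<sigma>
    where \<sigma>: "\<And>g. g \<in> carrier G \<Longrightarrow> \<sigma> g \<in> carrier_mat k k"
      and tw: "\<And>g. g \<in> carrier G \<Longrightarrow> \<rho> g * B = B * \<sigma> g" by blast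
  have "matrix_representation G k \<sigma>"
  proof
    fix g h assume g: "g \<in> carrier G" and h: "h \<in> carrier G"
    have "B * \<sigma> (g \<otimes> h) = \<rho> g * (\<rho> h * B)"
      using g h tw[of "g \<otimes> h"] rep_mult[OF g h] rep_carrier B(1)
      by (simp add: assoc_mult_mat[of _ n n _ n _ k])
    also have "\<dots> = \<rho> g * B * \<sigma> h"
      using tw[OF h] assoc_mult_mat[OF rep_carrier[OF g] B(1) \<sigma>[OF h]] by simp
    also have "\<dots> = B * (\<sigma> g * \<sigma> h)"
      using tw[OF g] assoc_mult_mat[OF B(1) \<sigma>[OF g] \<sigma>[OF h]] by simp
    finally show "\<sigma> (g \<otimes> h) = \<sigma> g * \<sigma> h"
      by (rule injective_mat_cancel_mat[OF B, rotated -1]) (use g h \<sigma> mult_carrier_mat[OF \<sigma>[OF g] \<sigma>[OF h]] in auto)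
  next
    have "B * \<sigma> \<one> = B * 1\<^sub>m k" using tw[OF one_closed] rep_one B(1) by simp
    then show "\<sigma> \<one> = 1\<^sub>m k"
      by (rule injective_mat_cancel_mat[OF B, rotated -1]) (use \<sigma> in auto)
  qed (use finite_carrier \<sigma> in auto)
  then show thesis using tw that by blast
qed

lemma invariant_range_restrict:
  assumes B: "invariant_range k B" and \<sigma>: "matrix_representation G k \<sigma>"
    and tw: "\<And>g. g \<in> carrier G \<Longrightarrow> \<rho> g * B = B * \<sigma> g"
    and C: "C \<in> carrier_mat k l" "injective_mat C" and W: "invariant_subspace G k \<sigma> ((*\<^sub>v) C ` carrier_vec l)"
  shows "invariant_range l (B * C)"
  unfolding invariant_range_def
proof (intro conjI ballI)
  interpret S: matrix_representation G k \<sigma> by (rule \<sigma>)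
  have Bc: "B \<in> carrier_mat n k" "injective_mat B" using B by (auto simp: invariant_range_def)
  show "B * C \<in> carrier_mat n l" using Bc C by simp
  show "injective_mat (B * C)" by (rule injective_mat_mult[OF Bc C])
  fix g and v :: "complex vec" assume g: "g \<in> carrier G" and v: "v \<in> carrier_vec l"
  then obtain w where w: "w \<in> carrier_vec l" "\<sigma> g *\<^sub>v (C *\<^sub>v v) = C *\<^sub>v w"
    using W by (auto simp: invariant_subspace_def)
  have Cv: "C *\<^sub>v v \<in> carrier_vec k" using C v by simp
  have "\<rho> g *\<^sub>v (B * C *\<^sub>v v) = (\<rho> g * B) *\<^sub>v (C *\<^sub>v v)"
    using assoc_mult_mat_vec[OF Bc(1) C(1) v] assoc_mult_mat_vec[OF rep_carrier[OF g] Bc(1) Cv] by simp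
  also have "\<dots> = B *\<^sub>v (C *\<^sub>v w)"
    using tw[OF g] assoc_mult_mat_vec[OF Bc(1) S.rep_carrier[OF g] Cv] w by simp
  also have "\<dots> = B * C *\<^sub>v w" using assoc_mult_mat_vec[OF Bc(1) C(1) w(1)] by simp
  finally show "\<rho> g *\<^sub>v (B * C *\<^sub>v v) \<in> (*\<^sub>v) (B * C) ` carrier_vec l" using w by blast
qed

lemma range_mult_mat:
  fixes B C :: "complex mat"
  assumes "B \<in> carrier_mat m k" "C \<in> carrier_mat k l"
  shows "(*\<^sub>v) (B * C) ` carrier_vec l = (*\<^sub>v) B ` (*\<^sub>v) C ` carrier_vec l"
  unfolding image_image using assoc_mult_mat_vec[OF assms] by (intro image_cong) auto

text \<open>A nonzero invariant subspace of \<open>U\<close> of least dimension is irreducible: if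
  \<open>C\<close> is a basis matrix of an invariant subspace in its coordinates, then
  \<open>B * C\<close> spans an invariant subspace of \<open>U\<close> of dimension
  \<open>l\<close>, whence \<open>l = 0\<close> or \<open>l = k\<close>.\<close>

lemma irreducible_subrepresentation:
  assumes U: "invariant_subspace G n \<rho> U" "U \<noteq> {0\<^sub>v n}"
  obtains k \<sigma> B where "irreducible_matrix_representation G k \<sigma>" "B \<in> carrier_mat n k" "injective_mat B"
    "\<forall>g\<in>carrier G. \<rho> g * B = B * \<sigma> g" "(*\<^sub>v) B ` carrier_vec k \<subseteq> U"
proof -
  define Q where "Q k \<longleftrightarrow> k > 0 \<and> (\<exists>B. invariant_range k B \<and> (*\<^sub>v) B ` carrier_vec k \<subseteq> U)" for k
  obtain k B where B: "B \<in> carrier_mat n k" "injective_mat B" "U = (*\<^sub>v) B ` carrier_vec k"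
    using subspace_eq_range U by (metis invariant_subspace_def)
  moreover have "k > 0"
  proof (rule ccontr)
    assume "\<not> k > 0"
    have "B *\<^sub>v v = 0\<^sub>v n" if "v \<in> carrier_vec k" for v
      using that B \<open>\<not> k > 0\<close> by (intro eq_vecI) (auto simp: scalar_prod_def)
    then have "U \<subseteq> {0\<^sub>v n}" using B by auto
    moreover have "0\<^sub>v n \<in> U"
      using U by (simp add: invariant_subspace_def subspace_module_vec_iff)
    ultimately show False using U by blast
  qed
  ultimately have "Q k"
    using U unfolding Q_def invariant_range_def invariant_subspace_def by blast
  \<comment> \<open>The space \<open>U\<close> itself has shown that some dimension qualifies; from
    here on \<open>k\<close> and \<open>B\<close> belong to a minimal choice.\<close>
  define k where "k = (LEAST k. Q k)"
  have "Q k" unfolding k_def by (rule LeastI) fact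
  then obtain B where kpos: "k > 0" and B: "invariant_range k B" "(*\<^sub>v) B ` carrier_vec k \<subseteq> U"
    by (auto simp: Q_def)
  have Bc: "B \<in> carrier_mat n k" "injective_mat B" using B by (auto simp: invariant_range_def)
  obtain \<sigma> where \<sigma>: "matrix_representation G k \<sigma>"
    and tw: "\<And>g. g \<in> carrier G \<Longrightarrow> \<rho> g * B = B * \<sigma> g"
    using invariant_rangeE[OF B(1)] by blast
  interpret S: matrix_representation G k \<sigma> by (rule \<sigma>)
  have irr: "irreducible_matrix_representation G k \<sigma>"
  proof
    show "k > 0" by fact
    fix W assume W: "invariant_subspace G k \<sigma> W"
    obtain l C where C: "C \<in> carrier_mat k l" "injective_mat C" "W = (*\<^sub>v) C ` carrier_vec l"
      using subspace_eq_range W by (metis invariant_subspace_def)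
    have "l \<le> k" by (rule injective_mat_le[OF C(1,2)])
    have BC: "invariant_range l (B * C)"
      by (rule invariant_range_restrict[OF B(1) \<sigma> tw C(1,2) W[unfolded C(3)]])
    have "(*\<^sub>v) (B * C) ` carrier_vec l \<subseteq> U"
      using B(2) C unfolding range_mult_mat[OF Bc(1) C(1)] by auto
    with BC have "l > 0 \<Longrightarrow> k \<le> l" unfolding k_def by (intro Least_le) (auto simp: Q_def)
    with \<open>l \<le> k\<close> consider "l = 0" | "l = k" by linarith
    then show "W = {0\<^sub>v k} \<or> W = carrier_vec k"
    proof cases
      case 1
      have Cv: "C *\<^sub>v v = 0\<^sub>v k" if "v \<in> carrier_vec l" for v
        using that C 1 by (intro eq_vecI) (auto simp: scalar_prod_def)
      have "W = (\<lambda>v :: complex vec. 0\<^sub>v k) ` carrier_vec l" unfolding C(3) by (rule image_cong) (auto simp: Cv)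
      also have "\<dots> = {0\<^sub>v k}" by (rule image_constant) (rule zero_carrier_vec)
      finally show ?thesis ..
    next
      case 2
      then have "carrier_vec k \<subseteq> W" using injective_mat_surj C by auto
      moreover have "W \<subseteq> carrier_vec k" using C 2 by auto
      ultimately show ?thesis by blast
    qed
  qed
  show thesis by (rule that[OF irr Bc _ B(2)]) (simp add: tw)
qed

end

section \<open>The regular representation, and separation of class functions by irreducible
  characters\<close>

text \<open>The enumeration \<open>e\<close> turns group elements into row and column indices; the
  matrix is the permutation matrix of left translation by \<open>g\<close>.\<close>

definition regular_rep :: "('a, 'b) monoid_scheme \<Rightarrow> (nat \<Rightarrow> 'a) \<Rightarrow> 'a \<Rightarrow> complex mat" where
  "regular_rep G e g = mat (card (carrier G)) (card (carrier G))
     (\<lambda>(i, j). if e i = g \<otimes>\<^bsub>G\<^esub> e j then 1 else 0)"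

lemma matrix_representation_regular_rep:
  fixes G (structure)
  assumes "group G" and fin: "finite (carrier G)" and e: "bij_betw e {..<card (carrier G)} (carrier G)"
  shows "matrix_representation G (card (carrier G)) (regular_rep G e)"
proof -
  interpret group G by fact
  let ?N = "card (carrier G)"
  have ec: "e i \<in> carrier G" if "i < ?N" for i using e that by (auto simp: bij_betw_def)
  have inj: "e i = e j \<longleftrightarrow> i = j" if "i < ?N" "j < ?N" for i j
    using e that by (auto simp: bij_betw_def inj_on_def)
  show ?thesis
  proof
    fix g h assume g: "g \<in> carrier G" and h: "h \<in> carrier G"
    show "regular_rep G e (g \<otimes> h) = regular_rep G e g * regular_rep G e h"
    proof (rule eq_matI)
      fix i j assume "i < dim_row (regular_rep G e g * regular_rep G e h)"
        "j < dim_col (regular_rep G e g * regular_rep G e h)"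
      then have ij: "i < ?N" "j < ?N" by (auto simp: regular_rep_def)
      have "(regular_rep G e g * regular_rep G e h) $$ (i, j) =
          (\<Sum>k<?N. (if e i = g \<otimes> e k then 1 else 0) * (if e k = h \<otimes> e j then 1 else 0))"
        using ij by (auto simp: regular_rep_def scalar_prod_def atLeast0LessThan intro!: sum.cong)
      also have "\<dots> = (\<Sum>y\<in>carrier G. (if e i = g \<otimes> y then 1 else 0) * (if y = h \<otimes> e j then 1 else 0))"
        using sum.reindex_bij_betw[OF e,
            of "\<lambda>y. (if e i = g \<otimes> y then 1 else 0) * (if y = h \<otimes> e j then 1 else 0 :: complex)"] .
      also have "\<dots> = (\<Sum>y\<in>carrier G. if y = h \<otimes> e j then (if e i = g \<otimes> (h \<otimes> e j) then 1 else 0) else 0)"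
        by (intro sum.cong) auto
      also have "\<dots> = (if e i = g \<otimes> (h \<otimes> e j) then 1 else 0)"
        using fin h ec[OF ij(2)] by simp
      also have "\<dots> = regular_rep G e (g \<otimes> h) $$ (i, j)"
        using ij g h ec by (simp add: regular_rep_def m_assoc)
      finally show "regular_rep G e (g \<otimes> h) $$ (i, j) = (regular_rep G e g * regular_rep G e h) $$ (i, j)" ..
    qed (auto simp: regular_rep_def)
  next
    show "regular_rep G e \<one> = 1\<^sub>m ?N"
      using ec inj by (intro eq_matI) (auto simp: regular_rep_def)
  qed (use fin in \<open>auto simp: regular_rep_def\<close>)
qed

text \<open>Since \<open>F\<close> and its adjoint \<open>F'\<close> are class sums of the regular representation, a nonzero \<open>F'\<close>
  has an irreducible subrepresentation in its range; there \<open>F\<close> acts as a class sum with trace zero,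
  so by Schur's lemma it vanishes. But \<open>F F' u = 0\<close> forces \<open>F' u = 0\<close>.\<close>

theorem class_function_eq_zero:
  fixes G (structure) and f :: "'a \<Rightarrow> complex"
  assumes G: "group G" and fin: "finite (carrier G)"
    and f: "\<And>x y. x \<in> carrier G \<Longrightarrow> y \<in> carrier G \<Longrightarrow> f (x \<otimes> y) = f (y \<otimes> x)"
    and orth: "\<And>\<chi>. \<chi> \<in> Irr G \<Longrightarrow> (\<Sum>x\<in>carrier G. f x * \<chi> x) = 0"
    and x: "x \<in> carrier G"
  shows "f x = 0"
proof (rule ccontr)
  assume fx: "f x \<noteq> 0"
  interpret group G by (rule G)
  define N where "N = card (carrier G)"
  obtain e where e: "bij_betw e {..<N} (carrier G)"
    using ex_bij_betw_nat_finite[OF fin] by (auto simp: N_def atLeast0LessThan)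
  define \<rho> where "\<rho> = regular_rep G e"
  interpret R: matrix_representation G N \<rho>
    using matrix_representation_regular_rep[OF G fin] e by (simp add: N_def \<rho>_def)
  have ec: "e i \<in> carrier G" if "i < N" for i using e that by (auto simp: bij_betw_def)
  \<comment> \<open>In the regular representation the coefficients can be read off the entries of a
    class sum.\<close>
  have S: "R.class_sum h $$ (i, j) = h (e i \<otimes> inv (e j))" if ij: "i < N" "j < N" for h i j
  proof -
    have "R.class_sum h $$ (i, j) = (\<Sum>y\<in>carrier G. (h y \<cdot>\<^sub>m \<rho> y) $$ (i, j))"
      using ij by (simp add: R.class_sum_def)
    also have "\<dots> = (\<Sum>y\<in>carrier G. if y = e i \<otimes> inv (e j) then h (e i \<otimes> inv (e j)) else 0)"
    proof (rule sum.cong[OF refl])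
      fix y assume y: "y \<in> carrier G"
      have "e i = y \<otimes> e j \<longleftrightarrow> y = e i \<otimes> inv (e j)"
        using ec[OF ij(1)] ec[OF ij(2)] y inv_solve_right[of y "e i" "e j"] by simp
      then show "(h y \<cdot>\<^sub>m \<rho> y) $$ (i, j) = (if y = e i \<otimes> inv (e j) then h (e i \<otimes> inv (e j)) else 0)"
        using ij by (simp add: \<rho>_def regular_rep_def N_def)
    qed
    also have "\<dots> = h (e i \<otimes> inv (e j))" using fin ec[OF ij(1)] ec[OF ij(2)] by simp
    finally show ?thesis .
  qed
  define F where "F = R.class_sum f"
  \<comment> \<open>These are the coefficients of the conjugate transpose of \<open>F\<close>, as
    \<open>adj\<close> confirms.\<close>
  define f' where "f' y = cnj (f (inv y))" for y
  define F' where "F' = R.class_sum f'"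
  have F: "F \<in> carrier_mat N N" "F' \<in> carrier_mat N N" by (simp_all add: F_def F'_def)
  have adj: "F' $$ (i, j) = cnj (F $$ (j, i))" if "i < N" "j < N" for i j
    using that ec by (simp add: F_def F'_def f'_def S inv_mult_group)
  have f': "f' (a \<otimes> b) = f' (b \<otimes> a)" if "a \<in> carrier G" "b \<in> carrier G" for a b
    using that f[of "inv a" "inv b"] by (simp add: f'_def inv_mult_group)
  define U where "U = (*\<^sub>v) F' ` carrier_vec N"
  have U: "invariant_subspace G N \<rho> U"
    unfolding U_def by (rule R.invariant_subspace_range) (use F R.class_sum_commutes[of f'] f' in \<open>auto simp: F'_def\<close>)
  obtain i where i: "i < N" "e i = inv x"
    using bij_betw_imp_surj_on[OF e] inv_closed[OF x] by (metis imageE lessThan_iff)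
  obtain j where j: "j < N" "e j = \<one>"
    using bij_betw_imp_surj_on[OF e] one_closed by (metis imageE lessThan_iff)
  \<comment> \<open>This entry is \<open>f' (inv x)\<close>, the conjugate of
    \<open>f x\<close>.\<close>
  have "F' $$ (i, j) \<noteq> 0"
    using fx i j x by (simp add: F'_def S f'_def)
  moreover have "F' *\<^sub>v unit_vec N j = col F' j"
    using col_mult2[OF F(2) one_carrier_mat j(1)] F j by simp
  ultimately have "(F' *\<^sub>v unit_vec N j) $ i \<noteq> 0" using F i j by simp
  then have "F' *\<^sub>v unit_vec N j \<noteq> 0\<^sub>v N" using i by auto
  moreover have "F' *\<^sub>v unit_vec N j \<in> U" unfolding U_def by (intro imageI unit_vec_carrier)
  ultimately have U0: "U \<noteq> {0\<^sub>v N}" by (metis singletonD)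
  obtain k \<sigma> B
    where \<sigma>: "irreducible_matrix_representation G k \<sigma>"
      and B: "B \<in> carrier_mat N k" "injective_mat B"
      and tw: "\<forall>g\<in>carrier G. \<rho> g * B = B * \<sigma> g"
      and BU: "(*\<^sub>v) B ` carrier_vec k \<subseteq> U"
    by (rule R.irreducible_subrepresentation[OF U U0])
  interpret I: irreducible_matrix_representation G k \<sigma> by (rule \<sigma>)
  \<comment> \<open>The intertwining relation carries the class sum over to \<open>\<sigma>\<close>,
    where orthogonality makes it vanish.\<close>
  have "F * B = mat_sum N k (\<lambda>y. f y \<cdot>\<^sub>m (\<rho> y * B)) (carrier G)"
    unfolding F_def by (rule R.class_sum_mult[OF B(1)])
  also have "\<dots> = mat_sum N k (\<lambda>y. f y \<cdot>\<^sub>m (B * \<sigma> y)) (carrier G)"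
    by (rule mat_sum_cong) (simp add: tw)
  also have "\<dots> = B * I.class_sum f" by (rule I.mult_class_sum[OF B(1), symmetric])
  also have "I.class_sum f = 0\<^sub>m k k"
    by (rule I.class_sum_eq_zero[of f, OF f orth[OF character_in_Irr[OF \<sigma>]]])
  finally have FB: "F * B = 0\<^sub>m N k" using B(1) by simp
  \<comment> \<open>A nonzero vector, since \<open>k > 0\<close> and \<open>B\<close> is injective;
    it lies in the kernel of \<open>F\<close> and in the range of \<open>F'\<close>.\<close>
  define w where "w = B *\<^sub>v unit_vec k 0"
  have wc: "w \<in> carrier_vec N" using B(1) by (simp add: w_def)
  have "F *\<^sub>v w = (F * B) *\<^sub>v unit_vec k 0"
    unfolding w_def using assoc_mult_mat_vec[OF F(1) B(1)] by simp
  then have Fw: "F *\<^sub>v w = 0\<^sub>v N" using FB by (intro eq_vecI) auto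
  have "w \<in> U" using BU by (auto simp: w_def)
  then obtain u where u: "u \<in> carrier_vec N" "w = F' *\<^sub>v u" by (auto simp: U_def)
  \<comment> \<open>With \<open>w = F' u\<close>, this moves \<open>F'\<close> across the inner
    product: the squared norm of \<open>w\<close> is the inner product of \<open>F w = 0\<close>
    with \<open>u\<close>.\<close>
  have "(\<Sum>i<N. w $ i * cnj (w $ i)) = (\<Sum>i<N. \<Sum>j<N. cnj (u $ j) * (F $$ (j, i) * w $ i))"
  proof (rule sum.cong[OF refl])
    fix i assume i: "i \<in> {..<N}"
    have "w $ i = (\<Sum>j<N. F' $$ (i, j) * u $ j)"
      using i u F by (auto simp: scalar_prod_def atLeast0LessThan intro!: sum.cong)
    then have "cnj (w $ i) = (\<Sum>j<N. F $$ (j, i) * cnj (u $ j))"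
      using i by (simp add: adj)
    then show "w $ i * cnj (w $ i) = (\<Sum>j<N. cnj (u $ j) * (F $$ (j, i) * w $ i))"
      by (simp add: sum_distrib_left mult_ac)
  qed
  also have "\<dots> = (\<Sum>j<N. cnj (u $ j) * (F *\<^sub>v w) $ j)"
  proof (subst sum.swap, rule sum.cong[OF refl])
    fix j assume j: "j \<in> {..<N}"
    have "(F *\<^sub>v w) $ j = (\<Sum>i<N. F $$ (j, i) * w $ i)"
      using j wc F by (auto simp: scalar_prod_def atLeast0LessThan intro!: sum.cong)
    then show "(\<Sum>i<N. cnj (u $ j) * (F $$ (j, i) * w $ i)) = cnj (u $ j) * (F *\<^sub>v w) $ j"
      by (simp add: sum_distrib_left)
  qed
  also have "\<dots> = 0" by (simp add: Fw)
  finally have "(\<Sum>i<N. (norm (w $ i))\<^sup>2) = 0"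
    by (simp only: complex_norm_square[symmetric] of_real_sum[symmetric] of_real_eq_0_iff)
  then have "w $ i = 0" if "i < N" for i
    using that by (subst (asm) sum_nonneg_eq_0_iff) auto
  then have "w = 0\<^sub>v N" using wc by (intro eq_vecI) auto
  then have "unit_vec k 0 = (0\<^sub>v k :: complex vec)"
    using B by (auto simp: w_def injective_mat_def)
  then have "unit_vec k 0 $ 0 = (0\<^sub>v k :: complex vec) $ 0" by simp
  then show False using I.dim_pos by simp
qed

section \<open>The norm of an irreducible character\<close>

context irreducible_matrix_representation
begin

definition elementary :: "nat \<Rightarrow> nat \<Rightarrow> complex mat" where
  "elementary j k = mat n n (\<lambda>(a, b). if a = j \<and> b = k then 1 else 0)"

text \<open>Sandwiching a matrix unit turns a product of two matrix coefficients into one entry of a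
  matrix, to which Schur's lemma can be applied after averaging.\<close>

lemma elementary_sandwich:
  assumes "A \<in> carrier_mat n n" "B \<in> carrier_mat n n" "j < n" "k < n" "a < n" "b < n"
  shows "(A * elementary j k * B) $$ (a, b) = A $$ (a, j) * B $$ (k, b)"
proof -
  have E: "(A * elementary j k) $$ (a, l) = (if l = k then A $$ (a, j) else 0)" if "l < n" for l
  proof -
    have "(A * elementary j k) $$ (a, l) = (\<Sum>i<n. A $$ (a, i) * (if i = j \<and> l = k then 1 else 0))"
      using assms that by (auto simp: elementary_def scalar_prod_def atLeast0LessThan intro!: sum.cong)
    also have "\<dots> = (\<Sum>i<n. if i = j then (if l = k then A $$ (a, j) else 0) else 0)"
      by (intro sum.cong) auto
    finally show ?thesis using assms by simp
  qed
  have "(A * elementary j k * B) $$ (a, b) = (\<Sum>l<n. (A * elementary j k) $$ (a, l) * B $$ (l, b))"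
    using assms by (auto simp: elementary_def scalar_prod_def atLeast0LessThan intro!: sum.cong)
  also have "\<dots> = (\<Sum>l<n. if l = k then A $$ (a, j) * B $$ (k, b) else 0)"
    by (intro sum.cong) (auto simp: E)
  finally show ?thesis using assms by simp
qed

definition averaged :: "complex mat \<Rightarrow> complex mat" where
  "averaged X = mat_sum n n (\<lambda>g. \<rho> g * X * \<rho> (inv g)) (carrier G)"

text \<open>Replacing \<open>g\<close> by \<open>h g\<close> in the sum brings out
  \<open>\<rho> h\<close> on the left and cancels it on the right.\<close>

lemma averaged_commutes:
  assumes X: "X \<in> carrier_mat n n" and h: "h \<in> carrier G"
  shows "averaged X * \<rho> h = \<rho> h * averaged X"
proof -
  have c: "\<rho> g * X * \<rho> (inv g) \<in> carrier_mat n n" if "g \<in> carrier G" for g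
    using rep_carrier[of "inv g"] rep_carrier[OF that] that X by auto
  have "averaged X * \<rho> h = mat_sum n n (\<lambda>g. \<rho> g * X * \<rho> (inv g) * \<rho> h) (carrier G)"
    unfolding averaged_def by (rule mat_sum_mult[OF rep_carrier[OF h] c])
  also have "\<dots> = mat_sum n n (\<lambda>g. \<rho> (h \<otimes> g) * X * \<rho> (inv (h \<otimes> g)) * \<rho> h) (carrier G)"
    by (rule mat_sum_reindex[OF bij_betw_left_translation[OF h]])
  also have "\<dots> = mat_sum n n (\<lambda>g. \<rho> h * (\<rho> g * X * \<rho> (inv g))) (carrier G)"
  proof (rule mat_sum_cong)
    fix g assume g: "g \<in> carrier G"
    have R: "\<rho> h \<in> carrier_mat n n" "\<rho> g \<in> carrier_mat n n" "\<rho> (inv g) \<in> carrier_mat n n"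
      "\<rho> (inv h) \<in> carrier_mat n n"
      using g h rep_carrier by auto
    have "\<rho> (h \<otimes> g) * X * \<rho> (inv (h \<otimes> g)) * \<rho> h = \<rho> h * (\<rho> g * (X * (\<rho> (inv g) * (\<rho> (inv h) * \<rho> h))))"
      using g h R X by (simp add: inv_mult_group rep_mult assoc_mult_mat[of _ n n _ n _ n])
    also have "\<dots> = \<rho> h * (\<rho> g * X * \<rho> (inv g))"
      using R X rep_inv[OF h] by (simp add: assoc_mult_mat[of _ n n _ n _ n])
    finally show "\<rho> (h \<otimes> g) * X * \<rho> (inv (h \<otimes> g)) * \<rho> h = \<rho> h * (\<rho> g * X * \<rho> (inv g))" .
  qed
  also have "\<dots> = \<rho> h * averaged X"
    unfolding averaged_def by (rule mult_mat_sum[OF rep_carrier[OF h] c, symmetric])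
  finally show ?thesis .
qed

lemma mat_trace_averaged:
  assumes X: "X \<in> carrier_mat n n"
  shows "mat_trace (averaged X) = of_nat (card (carrier G)) * mat_trace X"
proof -
  have c: "\<rho> g * X * \<rho> (inv g) \<in> carrier_mat n n" if "g \<in> carrier G" for g
    using rep_carrier[of "inv g"] rep_carrier[OF that] that X by auto
  have "mat_trace (\<rho> g * X * \<rho> (inv g)) = mat_trace X" if g: "g \<in> carrier G" for g
  proof -
    have R: "\<rho> g \<in> carrier_mat n n" "\<rho> (inv g) \<in> carrier_mat n n" using g rep_carrier by auto
    have "mat_trace (\<rho> g * X * \<rho> (inv g)) = mat_trace (\<rho> (inv g) * (\<rho> g * X))"
      using R X by (intro mat_trace_mult_comm[of _ n n]) auto
    also have "\<rho> (inv g) * (\<rho> g * X) = X"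
      using R X rep_inv(1)[OF g] assoc_mult_mat[OF R(2,1) X] by simp
    finally show ?thesis .
  qed
  then show ?thesis unfolding averaged_def by (simp add: mat_trace_mat_sum c)
qed

text \<open>Expanding both traces gives the entries at \<open>(j, k)\<close> of the averaged matrix
  units. By Schur's lemma each averaged unit is scalar and its trace determines it, so the entry is
  the group order over \<open>n\<close> if \<open>j = k\<close> and zero otherwise; there are
  \<open>n\<close> diagonal pairs.\<close>

theorem character_norm:
  "(\<Sum>g\<in>carrier G. (norm (character G \<rho> g))\<^sup>2) = card (carrier G)"
proof -
  let ?c = "of_nat (card (carrier G)) :: complex"
  have "complex_of_real (\<Sum>g\<in>carrier G. (norm (character G \<rho> g))\<^sup>2) =
      (\<Sum>g\<in>carrier G. mat_trace (\<rho> g) * mat_trace (\<rho> (inv g)))"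
    unfolding of_real_sum complex_norm_square
    by (intro sum.cong) (auto simp: character_def mat_trace_rep_inv)
  also have "\<dots> = (\<Sum>g\<in>carrier G. \<Sum>j<n. \<Sum>k<n. \<rho> g $$ (j, j) * \<rho> (inv g) $$ (k, k))"
    by (intro sum.cong) (auto simp: mat_trace_def sum_product)
  also have "\<dots> = (\<Sum>j<n. \<Sum>k<n. averaged (elementary j k) $$ (j, k))"
  proof -
    have "averaged (elementary j k) $$ (j, k) = (\<Sum>g\<in>carrier G. \<rho> g $$ (j, j) * \<rho> (inv g) $$ (k, k))"
      if "j < n" "k < n" for j k
    proof -
      have "averaged (elementary j k) $$ (j, k) =
          (\<Sum>g\<in>carrier G. (\<rho> g * elementary j k * \<rho> (inv g)) $$ (j, k))"
        using that by (simp add: averaged_def del: index_mult_mat)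
      also have "\<dots> = (\<Sum>g\<in>carrier G. \<rho> g $$ (j, j) * \<rho> (inv g) $$ (k, k))"
        using that rep_carrier by (intro sum.cong elementary_sandwich) auto
      finally show ?thesis .
    qed
    then show ?thesis by (simp add: sum.swap[of _ "carrier G"])
  qed
  also have "\<dots> = (\<Sum>j<n. \<Sum>k<n. if j = k then ?c / of_nat n else 0)"
  proof (intro sum.cong refl)
    fix j k assume jk: "j \<in> {..<n}" "k \<in> {..<n}"
    have E: "elementary j k \<in> carrier_mat n n" by (simp add: elementary_def)
    have "mat_trace (elementary j k) = (\<Sum>i<n. if i = j then (if j = k then 1 else 0) else 0)"
      unfolding mat_trace_def elementary_def by (intro sum.cong) auto
    then have tr: "mat_trace (elementary j k) = (if j = k then 1 else 0)" using jk by simp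
    have "averaged (elementary j k) = (mat_trace (averaged (elementary j k)) / of_nat n) \<cdot>\<^sub>m 1\<^sub>m n"
      by (rule mat_trace_schur) (auto simp: averaged_commutes[OF E], simp add: averaged_def)
    from arg_cong[OF this, of "\<lambda>M. M $$ (j, k)"]
    show "averaged (elementary j k) $$ (j, k) = (if j = k then ?c / of_nat n else 0)"
      using jk tr by (simp add: mat_trace_averaged[OF E])
  qed
  also have "\<dots> = ?c" using dim_pos by simp
  also have "\<dots> = complex_of_real (real (card (carrier G)))" by simp
  finally show ?thesis by (simp only: of_real_eq_iff)
qed

end

section \<open>Commutators and centers of characters\<close>

context group
begin

lemma inv_mult_cancel:
  "x \<in> carrier G \<Longrightarrow> y \<in> carrier G \<Longrightarrow> inv x \<otimes> (x \<otimes> y) = y"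
  "x \<in> carrier G \<Longrightarrow> y \<in> carrier G \<Longrightarrow> x \<otimes> (inv x \<otimes> y) = y"
  by (simp_all add: m_assoc[symmetric])

lemmas group_word_simps = m_assoc inv_mult_group inv_mult_cancel

lemma commutator_elts_subset: "g \<in> carrier G \<Longrightarrow> commutator_elts G g \<subseteq> carrier G"
  by (auto simp: commutator_elts_def)

lemma commutator_eltsI:
  "x \<in> carrier G \<Longrightarrow> inv g \<otimes> inv x \<otimes> g \<otimes> x \<in> commutator_elts G g"
  by (auto simp: commutator_elts_def)

lemma commutator_elts_image:
  "commutator_elts G g = (\<lambda>x. inv g \<otimes> inv x \<otimes> g \<otimes> x) ` carrier G"
  by (auto simp: commutator_elts_def)

lemma mult_commutator_elt:
  assumes "g \<in> carrier G" "y \<in> commutator_elts G g"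
  obtains t where "t \<in> carrier G" "g \<otimes> y = inv t \<otimes> g \<otimes> t"
  using assms by (auto simp: commutator_elts_def group_word_simps)

text \<open>The elements \<open>x y\<close> and \<open>y x\<close> are conjugate. This brings
  indicators of conjugation-closed sets into the form required of class functions.\<close>

lemma conj_closed_mem_comm:
  assumes A: "\<And>a t. a \<in> A \<Longrightarrow> t \<in> carrier G \<Longrightarrow> t \<otimes> a \<otimes> inv t \<in> A"
    and "x \<in> carrier G" "y \<in> carrier G"
  shows "x \<otimes> y \<in> A \<longleftrightarrow> y \<otimes> x \<in> A"
  using A[of "x \<otimes> y" y] A[of "y \<otimes> x" x] assms(2,3) by (auto simp: group_word_simps)

lemma commutator_elts_conj:
  assumes g: "g \<in> carrier G" and t: "t \<in> carrier G"
  shows "commutator_elts G (t \<otimes> g \<otimes> inv t) = (\<lambda>x. t \<otimes> x \<otimes> inv t) ` commutator_elts G g"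
proof -
  have "commutator_elts G (t \<otimes> g \<otimes> inv t) =
      (\<lambda>x. inv (t \<otimes> g \<otimes> inv t) \<otimes> inv x \<otimes> (t \<otimes> g \<otimes> inv t) \<otimes> x) `
        (\<lambda>x. t \<otimes> x \<otimes> inv t) ` carrier G"
    using bij_betw_imp_surj_on[OF bij_betw_conjugation[OF t]] by (simp add: commutator_elts_image)
  also have "\<dots> = (\<lambda>x. t \<otimes> x \<otimes> inv t) ` commutator_elts G g"
    unfolding commutator_elts_image image_image
    using g t by (intro image_cong) (auto simp: group_word_simps)
  finally show ?thesis .
qed

lemma finite_subgroupI:
  assumes fin: "finite (carrier G)" and H: "H \<subseteq> carrier G" "\<one> \<in> H"
    and mult: "\<And>a b. a \<in> H \<Longrightarrow> b \<in> H \<Longrightarrow> a \<otimes> b \<in> H"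
  shows "subgroup H G"
proof (rule subgroupI)
  fix a assume a: "a \<in> H"
  have "a [^] (k :: nat) \<in> H" for k
    by (induction k) (use H a mult in auto)
  moreover have "inv a = a [^] (card (carrier G) - 1)"
    using inv_eq_pow_card[OF fin] a H by auto
  ultimately show "inv a \<in> H" by simp
qed (use H mult in auto)

lemma normal_commutator_elts:
  assumes fin: "finite (carrier G)" and g: "g \<in> carrier G"
    and chain: "\<And>g h. g \<in> carrier G \<Longrightarrow> h \<in> carrier G \<Longrightarrow>
      commutator_elts G g \<subseteq> commutator_elts G h \<or> commutator_elts G h \<subseteq> commutator_elts G g"
  shows "commutator_elts G g \<lhd> G"
proof -
  let ?N = "commutator_elts G g"
  have N: "?N \<subseteq> carrier G" by (rule commutator_elts_subset[OF g])
  have finN: "finite ?N" using fin N by (rule rev_finite_subset)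
  have conj: "t \<otimes> a \<otimes> inv t \<in> ?N" if t: "t \<in> carrier G" and a: "a \<in> ?N" for t a
  proof -
    let ?M = "commutator_elts G (t \<otimes> g \<otimes> inv t)"
    have M: "?M = (\<lambda>x. t \<otimes> x \<otimes> inv t) ` ?N" by (rule commutator_elts_conj[OF g t])
    have "inj_on (\<lambda>x. t \<otimes> x \<otimes> inv t) ?N"
      using inj_on_subset[OF bij_betw_imp_inj_on[OF bij_betw_conjugation[OF t]] N] .
    then have "card ?M = card ?N" unfolding M by (rule card_image)
    moreover have "finite ?M" unfolding M using finN by simp
    moreover have "?M \<subseteq> ?N \<or> ?N \<subseteq> ?M" using g t by (intro chain) auto
    \<comment> \<open>Comparable finite sets of equal size coincide.\<close>
    ultimately have "?M = ?N" using finN by (metis card_subset_eq)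
    then show ?thesis using M a by blast
  qed
  have "subgroup ?N G"
  proof (rule finite_subgroupI[OF fin N])
    have "inv g \<otimes> inv \<one> \<otimes> g \<otimes> \<one> = \<one>" using g by simp
    then show "\<one> \<in> ?N" using commutator_eltsI[of \<one> g] by simp
    fix a b assume a: "a \<in> ?N" and b: "b \<in> ?N"
    then obtain y where y: "y \<in> carrier G" "a = inv g \<otimes> inv y \<otimes> g \<otimes> y"
      by (auto simp: commutator_elts_def)
    \<comment> \<open>Writing \<open>a = [g, y]\<close>, invariance under conjugation makes
      \<open>y b y^-1\<close> some \<open>[g, x]\<close>; then
      \<open>a b = [g, x y]\<close>.\<close>
    obtain x where x: "x \<in> carrier G" "y \<otimes> b \<otimes> inv y = inv g \<otimes> inv x \<otimes> g \<otimes> x"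
      using conj[OF y(1) b] by (auto simp: commutator_elts_def)
    have bc: "b \<in> carrier G" using b N by blast
    have "b = inv y \<otimes> (y \<otimes> b \<otimes> inv y) \<otimes> y" using bc y by (simp add: group_word_simps)
    then have "a \<otimes> b = inv g \<otimes> inv (x \<otimes> y) \<otimes> g \<otimes> (x \<otimes> y)"
      unfolding x(2) using g x y by (simp add: group_word_simps)
    then show "a \<otimes> b \<in> ?N" using commutator_eltsI[of "x \<otimes> y" g] x y by simp
  qed
  then show ?thesis using conj by (simp add: normal_inv_iff)
qed

end

section \<open>Kernels and centers of characters in terms of the representation\<close>

context matrix_representation
begin

lemma char_kernel_normal: "char_kernel G (character G \<rho>) \<lhd> G"
proof -
  interpret H: group_hom G "general_linear n" \<rho>
    by (intro group_hom.intro group_hom_axioms.intro group_axioms group_general_linear rep_hom)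
  have "char_kernel G (character G \<rho>) = kernel G (general_linear n) \<rho>"
    by (simp add: char_kernel_character kernel_def one_general_linear)
  then show ?thesis using H.normal_kernel by simp
qed

text \<open>Cosets of the kernel correspond to matrices in the image, so the center of the quotient
  can be tested on matrices.\<close>

lemma char_kernel_coset_eq_iff:
  assumes a: "a \<in> carrier G" and b: "b \<in> carrier G"
  shows "char_kernel G (character G \<rho>) #> a = char_kernel G (character G \<rho>) #> b \<longleftrightarrow> \<rho> a = \<rho> b"
proof
  let ?K = "char_kernel G (character G \<rho>)"
  interpret K: normal ?K G by (rule char_kernel_normal)
  show "\<rho> a = \<rho> b" if "?K #> a = ?K #> b"
  proof -
    have "a \<in> ?K #> b" using rcos_self[OF a K.subgroup_axioms] that by simp
    then obtain k where k: "k \<in> ?K" "a = k \<otimes> b" unfolding r_coset_def by blast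
    from k(1) have "k \<in> carrier G" "\<rho> k = 1\<^sub>m n" unfolding char_kernel_character by simp_all
    then show ?thesis using rep_mult[of k b] b rep_carrier[OF b] by (simp add: k(2))
  qed
  show "?K #> a = ?K #> b" if "\<rho> a = \<rho> b"
  proof -
    have "\<rho> (a \<otimes> inv b) = 1\<^sub>m n"
      using rep_mult[OF a inv_closed[OF b]] rep_inv(2)[OF b] by (simp only: that)
    then have "a \<otimes> inv b \<in> ?K" using a b unfolding char_kernel_character by simp
    then have "a \<otimes> inv b \<otimes> b \<in> ?K #> b" unfolding r_coset_def by blast
    then have "a \<in> ?K #> b" using a b by (simp only: m_assoc inv_closed l_inv r_one)
    from repr_independence[OF this b K.subgroup_axioms] show ?thesis ..
  qed
qed

lemma char_center_character:
  "char_center G (character G \<rho>) = {g \<in> carrier G. \<forall>x\<in>carrier G. \<rho> g * \<rho> x = \<rho> x * \<rho> g}"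
proof -
  let ?K = "char_kernel G (character G \<rho>)"
  interpret K: normal ?K G by (rule char_kernel_normal)
  have "?K #> g \<in> group_center (G Mod ?K) \<longleftrightarrow> (\<forall>x\<in>carrier G. \<rho> g * \<rho> x = \<rho> x * \<rho> g)"
    if g: "g \<in> carrier G" for g
  proof -
    have "?K #> g \<in> group_center (G Mod ?K) \<longleftrightarrow>
        (\<forall>x\<in>carrier G. (?K #> g) <#> (?K #> x) = (?K #> x) <#> (?K #> g))"
      using g by (auto simp: group_center_def FactGroup_def RCOSETS_def)
    also have "\<dots> \<longleftrightarrow> (\<forall>x\<in>carrier G. ?K #> (g \<otimes> x) = ?K #> (x \<otimes> g))"
      using g by (simp add: K.rcos_sum)
    also have "\<dots> \<longleftrightarrow> (\<forall>x\<in>carrier G. \<rho> g * \<rho> x = \<rho> x * \<rho> g)"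
      using g by (simp add: char_kernel_coset_eq_iff rep_mult)
    finally show ?thesis .
  qed
  then show ?thesis by (auto simp: char_center_def)
qed

text \<open>From \<open>g x = x g [g, x]\<close>, the matrices of \<open>g\<close> and
  \<open>x\<close> commute exactly when \<open>[g, x]\<close> acts trivially.\<close>

lemma char_center_iff_commutator_elts:
  assumes g: "g \<in> carrier G"
  shows "g \<in> char_center G (character G \<rho>) \<longleftrightarrow> commutator_elts G g \<subseteq> char_kernel G (character G \<rho>)"
proof -
  have "\<rho> g * \<rho> x = \<rho> x * \<rho> g \<longleftrightarrow> \<rho> (inv g \<otimes> inv x \<otimes> g \<otimes> x) = 1\<^sub>m n" if x: "x \<in> carrier G" for x
  proof -
    let ?c = "inv g \<otimes> inv x \<otimes> g \<otimes> x"
    have c: "?c \<in> carrier G" using g x by simp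
    have "\<rho> g * \<rho> x = \<rho> (x \<otimes> g) * \<rho> ?c" "\<rho> ?c = \<rho> (inv (x \<otimes> g)) * (\<rho> g * \<rho> x)"
      using g x rep_mult[of "x \<otimes> g" ?c] rep_mult[of "inv (x \<otimes> g)" "g \<otimes> x"]
      by (simp_all add: group_word_simps rep_mult[OF g x, symmetric])
    then show ?thesis
      using rep_inv(1)[of "x \<otimes> g"] rep_mult[OF x g] rep_carrier[of "x \<otimes> g"] g x by auto
  qed
  then show ?thesis using g by (auto simp: char_center_character char_kernel_character commutator_elts_def)
qed

lemma char_center_subgroup: "subgroup (char_center G (character G \<rho>)) G"
proof (rule finite_subgroupI[OF finite_carrier])
  show "\<one> \<in> char_center G (character G \<rho>)"
    by (auto simp: char_center_character rep_one rep_carrier left_mult_one_mat[OF rep_carrier]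
        right_mult_one_mat[OF rep_carrier])
  fix a b assume "a \<in> char_center G (character G \<rho>)" "b \<in> char_center G (character G \<rho>)"
  then have ab: "a \<in> carrier G" "b \<in> carrier G"
    and A: "\<And>x. x \<in> carrier G \<Longrightarrow> \<rho> a * \<rho> x = \<rho> x * \<rho> a"
    and B: "\<And>x. x \<in> carrier G \<Longrightarrow> \<rho> b * \<rho> x = \<rho> x * \<rho> b"
    by (auto simp: char_center_character)
  have "\<rho> (a \<otimes> b) * \<rho> x = \<rho> x * \<rho> (a \<otimes> b)" if x: "x \<in> carrier G" for x
  proof -
    note R = rep_carrier[OF ab(1)] rep_carrier[OF ab(2)] rep_carrier[OF x]
    have "\<rho> (a \<otimes> b) * \<rho> x = \<rho> a * (\<rho> x * \<rho> b)"
      using ab R B[OF x] by (simp add: rep_mult assoc_mult_mat[of _ n n _ n _ n])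
    also have "\<dots> = \<rho> x * \<rho> a * \<rho> b"
      using A[OF x] assoc_mult_mat[OF R(1,3,2)] by simp
    also have "\<dots> = \<rho> x * \<rho> (a \<otimes> b)"
      using ab assoc_mult_mat[OF R(3,1,2)] by (simp add: rep_mult)
    finally show ?thesis .
  qed
  then show "a \<otimes> b \<in> char_center G (character G \<rho>)"
    using ab by (simp add: char_center_character)
qed (auto simp: char_center_character)

lemma character_conj:
  assumes "g \<in> carrier G" "t \<in> carrier G"
  shows "character G \<rho> (inv t \<otimes> g \<otimes> t) = character G \<rho> g"
proof -
  have R: "\<rho> g \<in> carrier_mat n n" "\<rho> t \<in> carrier_mat n n" "\<rho> (inv t) \<in> carrier_mat n n"
    using assms rep_carrier by auto
  have "mat_trace (\<rho> (inv t \<otimes> g \<otimes> t)) = mat_trace (\<rho> (inv t) * \<rho> g * \<rho> t)"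
    using assms by (simp add: rep_mult)
  also have "\<dots> = mat_trace (\<rho> t * (\<rho> (inv t) * \<rho> g))"
    using R by (intro mat_trace_mult_comm[of _ n n]) auto
  also have "\<rho> t * (\<rho> (inv t) * \<rho> g) = \<rho> g"
    using R rep_inv(2)[OF assms(2)] assoc_mult_mat[OF R(2,3,1)] by simp
  finally show ?thesis using assms by (simp add: character_def)
qed

lemma character_mult_kernel:
  assumes "g \<in> carrier G" "x \<in> char_kernel G (character G \<rho>)"
  shows "character G \<rho> (g \<otimes> x) = character G \<rho> g"
proof -
  have x: "x \<in> carrier G" "\<rho> x = 1\<^sub>m n" using assms(2) by (auto simp: char_kernel_character)
  then have "\<rho> (g \<otimes> x) = \<rho> g" using rep_mult[OF assms(1) x(1)] rep_carrier[OF assms(1)] by simp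
  then show ?thesis using assms(1) x(1) by (simp add: character_def)
qed

end

section \<open>Character values on and off the center\<close>

context irreducible_matrix_representation
begin

text \<open>By Schur's lemma \<open>g\<close> and its inverse act by scalars \<open>c\<close> and
  \<open>d\<close> with \<open>c * d = 1\<close>; the squared modulus is the product of the two
  traces, \<open>c * d * n^2\<close>.\<close>

lemma norm_character_center:
  assumes g: "g \<in> char_center G (character G \<rho>)"
  shows "(norm (character G \<rho> g))\<^sup>2 = (real n)\<^sup>2"
proof -
  have gc: "g \<in> carrier G" "inv g \<in> carrier G" using g by (auto simp: char_center_character)
  have "inv g \<in> char_center G (character G \<rho>)"
    using g subgroup.m_inv_closed[OF char_center_subgroup] by blast
  then obtain c d where c: "\<rho> g = c \<cdot>\<^sub>m 1\<^sub>m n" and d: "\<rho> (inv g) = d \<cdot>\<^sub>m 1\<^sub>m n"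
    using schur[OF rep_carrier[OF gc(1)]] schur[OF rep_carrier[OF gc(2)]] g
    unfolding char_center_character by (smt (verit) mem_Collect_eq)
  have "(\<rho> g * \<rho> (inv g)) $$ (0, 0) = c * d"
    unfolding c d using dim_pos by simp
  then have "c * d = 1" using rep_inv(2)[OF gc(1)] dim_pos by simp
  have "complex_of_real ((norm (character G \<rho> g))\<^sup>2) = mat_trace (\<rho> g) * mat_trace (\<rho> (inv g))"
    unfolding complex_norm_square using gc by (simp add: character_def mat_trace_rep_inv)
  also have "\<dots> = c * d * (of_nat n)\<^sup>2"
    unfolding c d mat_trace_scalar by (simp add: power2_eq_square)
  also have "\<dots> = complex_of_real ((real n)\<^sup>2)" using \<open>c * d = 1\<close> by simp
  finally show ?thesis by (simp only: of_real_eq_iff)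
qed

text \<open>In \<open>character_norm\<close> the center contributes \<open>n^2\<close> times its
  order. By Lagrange, the degree condition says that this is already the whole sum, leaving zero for
  the nonnegative terms outside.\<close>

lemma fully_ramified_iff_vanishes:
  "(character G \<rho> \<one>)\<^sup>2 = of_nat (card (rcosets (char_center G (character G \<rho>)))) \<longleftrightarrow>
     (\<forall>g\<in>carrier G - char_center G (character G \<rho>). character G \<rho> g = 0)"
proof -
  let ?Z = "char_center G (character G \<rho>)"
  let ?q = "\<lambda>g. (norm (character G \<rho> g))\<^sup>2"
  have Z: "?Z \<subseteq> carrier G" by (auto simp: char_center_character)
  have "finite ?Z" using Z finite_carrier by (rule finite_subset)
  moreover have "\<one> \<in> ?Z" by (rule subgroup.one_closed[OF char_center_subgroup])
  ultimately have cZ: "card ?Z > 0" by (auto simp: card_gt_0_iff)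
  have lag: "card (rcosets ?Z) * card ?Z = card (carrier G)"
    using lagrange[OF char_center_subgroup] by (simp add: Coset.order_def)
  have "real (card (carrier G)) = (\<Sum>g\<in>carrier G - ?Z. ?q g) + (\<Sum>g\<in>?Z. ?q g)"
    using character_norm sum.subset_diff[OF Z finite_carrier, of ?q] by simp
  also have "(\<Sum>g\<in>?Z. ?q g) = (real n)\<^sup>2 * card ?Z"
    by (simp add: norm_character_center)
  finally have eq: "real (card (rcosets ?Z)) * card ?Z = (\<Sum>g\<in>carrier G - ?Z. ?q g) + (real n)\<^sup>2 * card ?Z"
    by (simp add: lag[symmetric])
  have "character G \<rho> \<one> = of_nat n" by (simp add: character_def rep_one)
  then have "(character G \<rho> \<one>)\<^sup>2 = of_nat (card (rcosets ?Z)) \<longleftrightarrow> n\<^sup>2 = card (rcosets ?Z)"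
    by (simp only: of_nat_power[symmetric] of_nat_eq_iff)
  also have "\<dots> \<longleftrightarrow> (real n)\<^sup>2 = real (card (rcosets ?Z))"
    by (simp only: of_nat_power[symmetric] of_nat_eq_iff)
  also have "\<dots> \<longleftrightarrow> (real n)\<^sup>2 * card ?Z = real (card (rcosets ?Z)) * card ?Z"
    using cZ by simp
  also have "\<dots> \<longleftrightarrow> (\<Sum>g\<in>carrier G - ?Z. ?q g) = 0" using eq by linarith
  also have "\<dots> \<longleftrightarrow> (\<forall>g\<in>carrier G - ?Z. character G \<rho> g = 0)"
    using finite_carrier by (subst sum_nonneg_eq_0_iff) auto
  finally show ?thesis .
qed

text \<open>The sum of \<open>\<rho>\<close> over a normal subgroup \<open>N\<close> is a scalar matrix fixed by multiplication with
  \<open>\<rho> k\<close> for \<open>k \<in> N\<close>, so it vanishes unless \<open>\<rho>\<close> is trivial on \<open>N\<close>.\<close>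

lemma sum_character_coset_eq_zero:
  assumes N: "N \<lhd> G" and nk: "\<not> N \<subseteq> char_kernel G (character G \<rho>)" and g: "g \<in> carrier G"
  shows "(\<Sum>x\<in>N. character G \<rho> (g \<otimes> x)) = 0"
proof -
  interpret N: normal N G by (rule N)
  define f :: "'a \<Rightarrow> complex" where "f x = (if x \<in> N then 1 else 0)" for x
  have NG: "N \<subseteq> carrier G" by (rule N.subset)
  have "x \<otimes> y \<in> N \<longleftrightarrow> y \<otimes> x \<in> N" if "x \<in> carrier G" "y \<in> carrier G" for x y
    by (rule conj_closed_mem_comm) (use that N.inv_op_closed2 in auto)
  then have f: "f (x \<otimes> y) = f (y \<otimes> x)" if "x \<in> carrier G" "y \<in> carrier G" for x y
    using that by (simp add: f_def)
  obtain c where c: "class_sum f = c \<cdot>\<^sub>m 1\<^sub>m n"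
    by (rule schur[OF class_sum_carrier class_sum_commutes[of f, OF f]])
  obtain k where k: "k \<in> N" "\<rho> k \<noteq> 1\<^sub>m n" using nk NG by (auto simp: char_kernel_character)
  then have kc: "k \<in> carrier G" using NG by blast
  \<comment> \<open>Translation by \<open>k\<close> permutes \<open>N\<close>, so
    \<open>\<rho> k\<close> fixes the scalar matrix \<open>class_sum f\<close>; as
    \<open>\<rho> k\<close> is not the identity, the scalar is zero.\<close>
  have "class_sum f = mat_sum n n (\<lambda>x. f (k \<otimes> x) \<cdot>\<^sub>m \<rho> (k \<otimes> x)) (carrier G)"
    unfolding class_sum_def by (rule mat_sum_reindex[OF bij_betw_left_translation[OF kc]])
  also have "\<dots> = mat_sum n n (\<lambda>x. f x \<cdot>\<^sub>m (\<rho> k * \<rho> x)) (carrier G)"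
  proof (rule mat_sum_cong)
    fix x assume x: "x \<in> carrier G"
    have "k \<otimes> x \<in> N \<longleftrightarrow> x \<in> N"
    proof
      assume "k \<otimes> x \<in> N"
      from N.m_closed[OF N.m_inv_closed[OF k(1)] this] show "x \<in> N"
        using x kc by (simp add: inv_mult_cancel)
    qed (rule N.m_closed[OF k(1)])
    then show "f (k \<otimes> x) \<cdot>\<^sub>m \<rho> (k \<otimes> x) = f x \<cdot>\<^sub>m (\<rho> k * \<rho> x)"
      using x kc by (simp add: f_def rep_mult)
  qed
  also have "\<dots> = \<rho> k * class_sum f" by (rule mult_class_sum[OF rep_carrier[OF kc], symmetric])
  also have "\<dots> = c \<cdot>\<^sub>m \<rho> k"
    unfolding c using rep_carrier[OF kc] by (simp add: mult_smult_distrib[OF _ one_carrier_mat])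
  finally have ck: "c \<cdot>\<^sub>m 1\<^sub>m n = c \<cdot>\<^sub>m \<rho> k" unfolding c .
  have "c = 0"
  proof (rule ccontr)
    assume "c \<noteq> 0"
    have "\<rho> k = 1\<^sub>m n"
    proof (rule eq_matI)
      fix i j assume "i < dim_row (1\<^sub>m n :: complex mat)" "j < dim_col (1\<^sub>m n :: complex mat)"
      then show "\<rho> k $$ (i, j) = 1\<^sub>m n $$ (i, j)"
        using arg_cong[OF ck, of "\<lambda>M. M $$ (i, j)"] \<open>c \<noteq> 0\<close> kc by (simp split: if_splits)
    qed (use kc in auto)
    then show False using k by simp
  qed
  have "\<rho> g * class_sum f = 0 \<cdot>\<^sub>m \<rho> g"
    unfolding c \<open>c = 0\<close> using rep_carrier[OF g] by (simp add: mult_smult_distrib[OF _ one_carrier_mat])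
  \<comment> \<open>The trace of \<open>\<rho> g * class_sum f\<close> is the sum of the character
    over the coset \<open>g N\<close>.\<close>
  then have "0 = mat_trace (\<rho> g * class_sum f)"
    using mat_trace_smult[OF rep_carrier[OF g], of 0] by simp
  also have "\<dots> = mat_trace (mat_sum n n (\<lambda>x. f x \<cdot>\<^sub>m (\<rho> g * \<rho> x)) (carrier G))"
    by (simp only: mult_class_sum[OF rep_carrier[OF g]])
  also have "\<dots> = (\<Sum>x\<in>carrier G. mat_trace (f x \<cdot>\<^sub>m (\<rho> g * \<rho> x)))"
    using rep_carrier[OF g] rep_carrier by (intro mat_trace_mat_sum smult_carrier_mat mult_carrier_mat) auto
  also have "\<dots> = (\<Sum>x\<in>carrier G. if x \<in> N then character G \<rho> (g \<otimes> x) else 0)"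
  proof (rule sum.cong[OF refl])
    fix x assume x: "x \<in> carrier G"
    show "mat_trace (f x \<cdot>\<^sub>m (\<rho> g * \<rho> x)) = (if x \<in> N then character G \<rho> (g \<otimes> x) else 0)"
      using g x mat_trace_smult[OF rep_carrier[of "g \<otimes> x"]] by (simp add: f_def character_def rep_mult)
  qed
  also have "\<dots> = (\<Sum>x\<in>N. character G \<rho> (g \<otimes> x))"
    using sum.inter_restrict[OF finite_carrier, of "\<lambda>x. character G \<rho> (g \<otimes> x)" N] NG
    by (simp add: Int_absorb1)
  finally show ?thesis ..
qed

end

text \<open>For \<open>g\<close> in a group, the irreducible characters \<open>\<chi>\<close> with \<open>g \<in> Z(\<chi>)\<close> are those whose kernel
  contains \<open>\<gamma>(g)\<close>; their kernels intersect in the following normal subgroup.\<close>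

definition central_kernel :: "('a, 'b) monoid_scheme \<Rightarrow> 'a \<Rightarrow> 'a set" where
  "central_kernel G g =
     {x \<in> carrier G. \<forall>\<chi>\<in>Irr G. g \<in> char_center G \<chi> \<longrightarrow> x \<in> char_kernel G \<chi>}"

section \<open>Irreducible characters and central kernels\<close>

context group
begin

context
  assumes fin: "finite (carrier G)"
begin

lemma Irr_kernel_normal:
  assumes "\<chi> \<in> Irr G"
  shows "char_kernel G \<chi> \<lhd> G"
proof -
  obtain n \<rho> where \<rho>: "irreducible_matrix_representation G n \<rho>" "\<chi> = character G \<rho>"
    using IrrE[OF group_axioms fin assms] .
  interpret irreducible_matrix_representation G n \<rho> by (rule \<rho>)
  show ?thesis unfolding \<rho>(2) by (rule char_kernel_normal)
qed

lemma Irr_center_iff: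
  assumes "\<chi> \<in> Irr G" "g \<in> carrier G"
  shows "g \<in> char_center G \<chi> \<longleftrightarrow> commutator_elts G g \<subseteq> char_kernel G \<chi>"
proof -
  obtain n \<rho> where \<rho>: "irreducible_matrix_representation G n \<rho>" "\<chi> = character G \<rho>"
    using IrrE[OF group_axioms fin assms(1)] .
  interpret irreducible_matrix_representation G n \<rho> by (rule \<rho>)
  show ?thesis unfolding \<rho>(2) by (rule char_center_iff_commutator_elts[OF assms(2)])
qed

text \<open>Both directions of the theorem use the degree condition only in this form.\<close>

lemma GVZ_group_iff_vanishing:
  "GVZ_group G \<longleftrightarrow> (\<forall>\<chi>\<in>Irr G. \<forall>g\<in>carrier G - char_center G \<chi>. \<chi> g = 0)"
proof -
  have "(\<chi> \<one>)\<^sup>2 = of_nat (card (rcosets (char_center G \<chi>))) \<longleftrightarrow>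
      (\<forall>g\<in>carrier G - char_center G \<chi>. \<chi> g = 0)" if \<chi>: "\<chi> \<in> Irr G" for \<chi>
  proof -
    obtain n \<rho> where \<rho>: "irreducible_matrix_representation G n \<rho>" "\<chi> = character G \<rho>"
      using IrrE[OF group_axioms fin \<chi>] .
    interpret irreducible_matrix_representation G n \<rho> by (rule \<rho>)
    show ?thesis unfolding \<rho>(2) by (rule fully_ramified_iff_vanishes)
  qed
  then show ?thesis by (simp add: GVZ_group_def)
qed

lemma central_kernel_normal:
  assumes "g \<in> carrier G"
  shows "central_kernel G g \<lhd> G"
proof -
  have K: "subgroup (char_kernel G \<chi>) G"
    "\<And>x t. x \<in> char_kernel G \<chi> \<Longrightarrow> t \<in> carrier G \<Longrightarrow> t \<otimes> x \<otimes> inv t \<in> char_kernel G \<chi>"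
    if "\<chi> \<in> Irr G" for \<chi>
    using Irr_kernel_normal[OF that] by (auto simp: normal_inv_iff)
  have "subgroup (central_kernel G g) G"
    by (rule finite_subgroupI[OF fin])
      (auto simp: central_kernel_def intro: subgroup.one_closed[OF K(1)] subgroup.m_closed[OF K(1)])
  moreover have "t \<otimes> x \<otimes> inv t \<in> central_kernel G g"
    if "t \<in> carrier G" "x \<in> central_kernel G g" for t x
    using that K(2) by (auto simp: central_kernel_def)
  ultimately show ?thesis by (auto simp: normal_inv_iff)
qed

lemma commutator_elts_subset_central_kernel:
  assumes g: "g \<in> carrier G"
  shows "commutator_elts G g \<subseteq> central_kernel G g"
proof
  fix x assume x: "x \<in> commutator_elts G g"
  then have "x \<in> carrier G" using commutator_elts_subset[OF g] by blast
  moreover have "x \<in> char_kernel G \<chi>" if "\<chi> \<in> Irr G" "g \<in> char_center G \<chi>" for \<chi>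
    using Irr_center_iff[OF that(1) g] that(2) x by blast
  ultimately show "x \<in> central_kernel G g" by (simp add: central_kernel_def)
qed

lemma sum_Irr_conjugacy_class:
  assumes \<chi>: "\<chi> \<in> Irr G" and g: "g \<in> carrier G"
  shows "(\<Sum>x\<in>(\<lambda>t. inv t \<otimes> g \<otimes> t) ` carrier G. \<chi> x) =
    of_nat (card ((\<lambda>t. inv t \<otimes> g \<otimes> t) ` carrier G)) * \<chi> g"
proof -
  obtain n \<rho> where \<rho>: "irreducible_matrix_representation G n \<rho>" "\<chi> = character G \<rho>"
    using IrrE[OF group_axioms fin \<chi>] .
  interpret irreducible_matrix_representation G n \<rho> by (rule \<rho>)
  have "(\<Sum>x\<in>(\<lambda>t. inv t \<otimes> g \<otimes> t) ` carrier G. \<chi> x) = (\<Sum>x\<in>(\<lambda>t. inv t \<otimes> g \<otimes> t) ` carrier G. \<chi> g)"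
    by (rule sum.cong) (auto simp: \<rho>(2) character_conj[OF g])
  then show ?thesis by simp
qed

text \<open>If \<open>g\<close> is central for the character, the central kernel lies in its kernel
  and the summands are constant. Otherwise the central kernel, which contains the commutator set, is
  not in the kernel, and both sides are zero.\<close>

lemma sum_Irr_coset_central_kernel:
  assumes \<chi>: "\<chi> \<in> Irr G" and g: "g \<in> carrier G" and GVZ: "GVZ_group G"
  shows "(\<Sum>x\<in>central_kernel G g. \<chi> (g \<otimes> x)) = of_nat (card (central_kernel G g)) * \<chi> g"
proof -
  obtain n \<rho> where \<rho>: "irreducible_matrix_representation G n \<rho>" "\<chi> = character G \<rho>"
    using IrrE[OF group_axioms fin \<chi>] .
  interpret irreducible_matrix_representation G n \<rho> by (rule \<rho>)
  show ?thesis
  proof (cases "g \<in> char_center G \<chi>")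
    case True
    then have "\<chi> (g \<otimes> x) = \<chi> g" if "x \<in> central_kernel G g" for x
      using that \<chi> character_mult_kernel[OF g] by (auto simp: central_kernel_def \<rho>(2))
    then show ?thesis by simp
  next
    case False
    then have "\<not> central_kernel G g \<subseteq> char_kernel G \<chi>"
      using Irr_center_iff[OF \<chi> g] commutator_elts_subset_central_kernel[OF g] by blast
    then have "(\<Sum>x\<in>central_kernel G g. \<chi> (g \<otimes> x)) = 0"
      using sum_character_coset_eq_zero[OF central_kernel_normal[OF g] _ g] by (simp add: \<rho>(2))
    moreover have "\<chi> g = 0" using False GVZ \<chi> g by (simp add: GVZ_group_iff_vanishing)
    ultimately show ?thesis by simp
  qed
qed

text \<open>The normalised indicator functions of the conjugacy class of \<open>g\<close> and of the coset
  \<open>g N\<close> with \<open>N = central_kernel G g\<close> have the same inner product with every irreducible character,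
  so they are equal.\<close>

lemma commutator_elts_eq_central_kernel:
  assumes g: "g \<in> carrier G" and GVZ: "GVZ_group G"
  shows "commutator_elts G g = central_kernel G g"
proof (rule equalityI[OF commutator_elts_subset_central_kernel[OF g]])
  let ?N = "central_kernel G g"
  interpret N: normal ?N G by (rule central_kernel_normal[OF g])
  define A where "A = (\<lambda>t. inv t \<otimes> g \<otimes> t) ` carrier G"
  define B where "B = (\<lambda>x. g \<otimes> x) ` ?N"
  have NG: "?N \<subseteq> carrier G" by (rule N.subset)
  have AG: "A \<subseteq> carrier G" and BG: "B \<subseteq> carrier G" using g NG by (auto simp: A_def B_def)
  have inj: "inj_on (\<lambda>x. g \<otimes> x) ?N"
    using inj_on_subset[OF bij_betw_imp_inj_on[OF bij_betw_left_translation[OF g]] NG] .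
  have cB: "card B = card ?N" unfolding B_def by (rule card_image[OF inj])
  have finA: "finite A" and finB: "finite B" using AG BG fin by (auto intro: finite_subset)
  have cA0: "card A \<noteq> 0" using finA by (auto simp: A_def)
  have "g \<otimes> \<one> \<in> B" unfolding B_def by (intro imageI N.one_closed)
  then have cB0: "card B \<noteq> 0" using finB by auto
  have Aconj: "t \<otimes> a \<otimes> inv t \<in> A" if a: "a \<in> A" and t: "t \<in> carrier G" for a t
  proof -
    obtain s where s: "s \<in> carrier G" "a = inv s \<otimes> g \<otimes> s" using a by (auto simp: A_def)
    have "t \<otimes> a \<otimes> inv t = inv (s \<otimes> inv t) \<otimes> g \<otimes> (s \<otimes> inv t)"
      using s t g by (simp add: group_word_simps)
    then show ?thesis using s t by (auto simp: A_def)
  qed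
  \<comment> \<open>Conjugating \<open>g x\<close> gives \<open>g [g, t^-1] (t x t^-1)\<close>; the
    coset is stable because the central kernel is normal and contains the commutators of
    \<open>g\<close>.\<close>
  have Bconj: "t \<otimes> b \<otimes> inv t \<in> B" if b: "b \<in> B" and t: "t \<in> carrier G" for b t
  proof -
    obtain x where x: "x \<in> ?N" "b = g \<otimes> x" using b by (auto simp: B_def)
    have xc: "x \<in> carrier G" using x NG by blast
    have "inv g \<otimes> inv (inv t) \<otimes> g \<otimes> inv t \<in> ?N"
      using commutator_eltsI[of "inv t" g] commutator_elts_subset_central_kernel[OF g] t by blast
    moreover have "t \<otimes> x \<otimes> inv t \<in> ?N" by (rule N.inv_op_closed2[OF t x(1)])
    ultimately have "inv g \<otimes> inv (inv t) \<otimes> g \<otimes> inv t \<otimes> (t \<otimes> x \<otimes> inv t) \<in> ?N" by (rule N.m_closed)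
    moreover have "t \<otimes> b \<otimes> inv t = g \<otimes> (inv g \<otimes> inv (inv t) \<otimes> g \<otimes> inv t \<otimes> (t \<otimes> x \<otimes> inv t))"
      using x(2) xc t g by (simp add: group_word_simps)
    ultimately show ?thesis unfolding B_def by (metis imageI)
  qed
  define f :: "'a \<Rightarrow> complex" where
    "f x = (if x \<in> A then 1 / of_nat (card A) else 0) - (if x \<in> B then 1 / of_nat (card B) else 0)" for x
  have f0: "f x = 0" if x: "x \<in> carrier G" for x
  proof (rule class_function_eq_zero[OF group_axioms fin _ _ x])
    show "f (x \<otimes> y) = f (y \<otimes> x)" if "x \<in> carrier G" "y \<in> carrier G" for x y
      using conj_closed_mem_comm[of A, OF Aconj that] conj_closed_mem_comm[of B, OF Bconj that]
      by (simp add: f_def)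
    fix \<chi> assume \<chi>: "\<chi> \<in> Irr G"
    have "(\<Sum>x\<in>carrier G. f x * \<chi> x) =
        (\<Sum>x\<in>carrier G. if x \<in> A then \<chi> x / of_nat (card A) else 0) -
        (\<Sum>x\<in>carrier G. if x \<in> B then \<chi> x / of_nat (card B) else 0)"
      unfolding sum_subtractf[symmetric] by (intro sum.cong) (auto simp: f_def left_diff_distrib)
    also have "\<dots> = (\<Sum>x\<in>A. \<chi> x / of_nat (card A)) - (\<Sum>x\<in>B. \<chi> x / of_nat (card B))"
      using AG BG fin by (simp add: sum.inter_restrict[symmetric] Int_absorb1)
    also have "(\<Sum>x\<in>A. \<chi> x / of_nat (card A)) = \<chi> g"
      using sum_Irr_conjugacy_class[OF \<chi> g] cA0 by (simp add: sum_divide_distrib[symmetric] A_def)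
    also have "(\<Sum>x\<in>B. \<chi> x / of_nat (card B)) = (\<Sum>x\<in>?N. \<chi> (g \<otimes> x)) / of_nat (card B)"
      unfolding sum_divide_distrib[symmetric] by (simp add: B_def sum.reindex[OF inj])
    also have "\<dots> = \<chi> g"
      using sum_Irr_coset_central_kernel[OF \<chi> g GVZ] cB cB0 by simp
    finally show "(\<Sum>x\<in>carrier G. f x * \<chi> x) = 0" by simp
  qed
  show "?N \<subseteq> commutator_elts G g"
  proof
    fix y assume y: "y \<in> ?N"
    then have yc: "y \<in> carrier G" using NG by blast
    have "g \<otimes> y \<in> B" using y by (simp add: B_def)
    \<comment> \<open>On \<open>B\<close> the second term of \<open>f\<close> is nonzero, so only
      the first can cancel it.\<close>
    then have "g \<otimes> y \<in> A" using f0[of "g \<otimes> y"] g yc cB0 by (auto simp: f_def split: if_splits)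
    then obtain t where t: "t \<in> carrier G" "g \<otimes> y = inv t \<otimes> g \<otimes> t" by (auto simp: A_def)
    have "y = inv g \<otimes> (g \<otimes> y)" using g yc by (simp add: inv_mult_cancel)
    also have "\<dots> = inv g \<otimes> inv t \<otimes> g \<otimes> t" unfolding t(2) using g t(1) by (simp add: m_assoc)
    finally show "y \<in> commutator_elts G g" using commutator_eltsI[OF t(1)] by simp
  qed
qed

section \<open>Chains of centers and chains of commutator sets\<close>

text \<open>More centers containing an element means more kernels to intersect. If some center
  contains \<open>g\<close> but not \<open>h\<close>, nestedness puts it inside every center
  containing \<open>h\<close>, so all of those contain \<open>g\<close>.\<close>

lemma nested_imp_central_kernel_chain:
  assumes nested: "nested_group G"
  shows "central_kernel G g \<subseteq> central_kernel G h \<or> central_kernel G h \<subseteq> central_kernel G g"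
proof (cases "\<forall>\<chi>\<in>Irr G. g \<in> char_center G \<chi> \<longrightarrow> h \<in> char_center G \<chi>")
  case True
  then show ?thesis by (auto simp: central_kernel_def)
next
  case False
  then obtain \<chi> where \<chi>: "\<chi> \<in> Irr G" "g \<in> char_center G \<chi>" "h \<notin> char_center G \<chi>" by blast
  then have "g \<in> char_center G \<psi>" if "\<psi> \<in> Irr G" "h \<in> char_center G \<psi>" for \<psi>
    using nested that unfolding nested_group_def by blast
  then show ?thesis by (auto simp: central_kernel_def)
qed

text \<open>Take \<open>g\<close> only in the center of \<open>\<chi>\<close> and \<open>h\<close>
  only in that of \<open>\<psi>\<close>. An inclusion between their commutator sets would put that
  of \<open>g\<close> into the kernel of \<open>\<psi>\<close> or that of \<open>h\<close> into the
  kernel of \<open>\<chi>\<close>.\<close>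

lemma commutator_chain_imp_nested:
  assumes chain: "\<And>g h. g \<in> carrier G \<Longrightarrow> h \<in> carrier G \<Longrightarrow>
      commutator_elts G g \<subseteq> commutator_elts G h \<or> commutator_elts G h \<subseteq> commutator_elts G g"
  shows "nested_group G"
  unfolding nested_group_def
proof (intro ballI, rule ccontr)
  fix \<chi> \<psi> assume \<chi>: "\<chi> \<in> Irr G" and \<psi>: "\<psi> \<in> Irr G"
    and "\<not> (char_center G \<chi> \<subseteq> char_center G \<psi> \<or> char_center G \<psi> \<subseteq> char_center G \<chi>)"
  then obtain g h where g: "g \<in> char_center G \<chi>" "g \<notin> char_center G \<psi>"
    and h: "h \<in> char_center G \<psi>" "h \<notin> char_center G \<chi>" by blast
  then have gh: "g \<in> carrier G" "h \<in> carrier G" by (auto simp: char_center_def)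
  show False
    using chain[OF gh] g h Irr_center_iff[OF \<chi> gh(1)] Irr_center_iff[OF \<psi> gh(1)]
      Irr_center_iff[OF \<chi> gh(2)] Irr_center_iff[OF \<psi> gh(2)] by blast
qed

lemma commutator_chain_imp_GVZ:
  assumes chain: "\<And>g h. g \<in> carrier G \<Longrightarrow> h \<in> carrier G \<Longrightarrow>
      commutator_elts G g \<subseteq> commutator_elts G h \<or> commutator_elts G h \<subseteq> commutator_elts G g"
  shows "GVZ_group G"
  unfolding GVZ_group_iff_vanishing
proof (intro ballI)
  fix \<chi> g assume \<chi>: "\<chi> \<in> Irr G" and "g \<in> carrier G - char_center G \<chi>"
  then have g: "g \<in> carrier G" "g \<notin> char_center G \<chi>" by auto
  obtain n \<rho> where \<rho>: "irreducible_matrix_representation G n \<rho>" "\<chi> = character G \<rho>"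
    using IrrE[OF group_axioms fin \<chi>] .
  interpret irreducible_matrix_representation G n \<rho> by (rule \<rho>)
  let ?N = "commutator_elts G g"
  have N: "?N \<lhd> G" by (rule normal_commutator_elts[OF fin g(1) chain])
  have "\<chi> (g \<otimes> x) = \<chi> g" if "x \<in> ?N" for x
    using mult_commutator_elt[OF g(1) that] character_conj[OF g(1)] by (metis \<rho>(2))
  then have "of_nat (card ?N) * \<chi> g = (\<Sum>x\<in>?N. \<chi> (g \<otimes> x))" by simp
  also have "\<dots> = 0"
    using sum_character_coset_eq_zero[OF N _ g(1)] Irr_center_iff[OF \<chi> g(1)] g(2) by (simp add: \<rho>(2))
  \<comment> \<open>Finiteness is needed here because \<open>card\<close> is zero on infinite
    sets.\<close>
  moreover have "card ?N \<noteq> 0"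
    using finite_subset[OF commutator_elts_subset[OF g(1)] fin] by (auto simp: commutator_elts_def)
  ultimately show "\<chi> g = 0" by simp
qed

end

end

theorem theorem2:
  fixes G :: "('a, 'b) monoid_scheme"
  assumes "group G"
    and "finite (carrier G)"
    and "\<not> comm_group G"
  shows "nested_group G \<and> GVZ_group G \<longleftrightarrow>
    (\<forall>g\<in>carrier G. \<forall>h\<in>carrier G.
       commutator_elts G g \<subseteq> commutator_elts G h \<or>
       commutator_elts G h \<subseteq> commutator_elts G g)"
proof -
  interpret group G by (rule assms(1))
  note fin = assms(2)
  show ?thesis
  proof
    assume "nested_group G \<and> GVZ_group G"
    then show "\<forall>g\<in>carrier G. \<forall>h\<in>carrier G.
        commutator_elts G g \<subseteq> commutator_elts G h \<or> commutator_elts G h \<subseteq> commutator_elts G g"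
      using nested_imp_central_kernel_chain[OF fin] commutator_elts_eq_central_kernel[OF fin] by simp
  next
    assume "\<forall>g\<in>carrier G. \<forall>h\<in>carrier G.
        commutator_elts G g \<subseteq> commutator_elts G h \<or> commutator_elts G h \<subseteq> commutator_elts G g"
    then show "nested_group G \<and> GVZ_group G"
      using commutator_chain_imp_nested[OF fin] commutator_chain_imp_GVZ[OF fin] by blast
  qed
qed

end
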